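(* Let $(u_k)_{k\ge 0}$ be the renewal sequence associated with uniform stick-breaking (defined in the context). Then $(u_k)_{k\ge0}$ is characterized by any one of the following equivalent conditions (that is, $(u_k)_{k\ge 0}$ satisfies each of them, and for a sequence of real numbers indexed by $k\ge 0$ the four conditions are equivalent and determine the sequence): (i) The sequence $(u_k)_{k\ge 0}$ is defined recursively by $u_0=1$, $u_1=1/2$ and $$2u_k+3u_{k-1}+u_{k-2}=2\zeta(k)\qquad (k\ge 2).$$ (ii) For all $k\ge 0$, $$u_k=(-1)^{k-1}\Bigl(2-\frac{3}{2^k}\Bigr)+\sum_{j=2}^{k}(-1)^{k-j}\Bigl(2-\frac{1}{2^{k-j}}\Bigr)\zeta(j).$$ (iii) For all $k\ge 0$, $$u_k=\sum_{j=1}^\infty \frac{2}{j^k(j+1)(j+2)}.$$ (iv) For $|z|<1$, the generating function of $(u_k)_{k\ge0}$ is $$U(z):=\sum_{k=0}^\infty u_kz^k=\frac{2}{(1+z)(2+z)}\Bigl[1+\bigl(2-\gamma-\psi(1-z)\bigr)z\Bigr].$$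
   Context: Uniform stick-breaking: let $W_1,W_2,\ldots$ be i.i.d. uniform on $[0,1]$. Set $R_0:=0$, $R_k:=1-\prod_{i=1}^k(1-W_i)$, $I_k:=[R_{k-1},R_k)$ and $P_k:=|I_k|=W_k\prod_{i=1}^{k-1}(1-W_i)$, so that $R_k=\sum_{i=1}^kP_i$. Let $(U_1,U_2,\ldots)$ be i.i.d. uniform on $[0,1]$, independent of $(W_i)$. For $k\ge1$ let $n(k,1):=\min\{n\ge1: U_n\notin[0,R_k)\}$ be the first time a sample point falls outside $[0,R_k)$. Define $u_0:=1$ and, for $k\ge 1$, $$u_k:=\mathbb P\Bigl(\bigcap_{i=1}^k\{U_j\in I_i\text{ for some }1\le j<n(k,1)\}\Bigr).$$ Notation: $\zeta(s)=\sum_{n\ge1}n^{-s}$ is the Riemann zeta function; $\gamma=\lim_{n\to\infty}(\sum_{k=1}^n1/k-\ln n)$ is the Euler constant; $\psi(z)=\Gamma'(z)/\Gamma(z)$ is the digamma function. Empty sums are $0$. *)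

theory Defs
  imports "HOL-Probability.Probability"
begin

text \<open>
  The sequences \<open>W\<close> and \<open>U\<close> are indexed by the positive naturals; the values
  \<open>W 0\<close> and \<open>U 0\<close> are never used.
\<close>

definition iid_uniform_01 :: "'a measure \<Rightarrow> (nat \<Rightarrow> 'a \<Rightarrow> real) \<Rightarrow> bool" where
  "iid_uniform_01 M X \<longleftrightarrow>
     prob_space.indep_vars M (\<lambda>_. borel) X {1..} \<and>
     (\<forall>i\<ge>1. distr M borel (X i) = uniform_measure lborel {0..1})"

definition uniform_stick_breaking ::
    "'a measure \<Rightarrow> (nat \<Rightarrow> 'a \<Rightarrow> real) \<Rightarrow> (nat \<Rightarrow> 'a \<Rightarrow> real) \<Rightarrow> bool" where
  "uniform_stick_breaking M W U \<longleftrightarrow>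
     prob_space M \<and> iid_uniform_01 M W \<and> iid_uniform_01 M U \<and>
     prob_space.indep_var M
       (PiM {1..} (\<lambda>_. borel)) (\<lambda>\<omega>. \<lambda>i\<in>{1..}. W i \<omega>)
       (PiM {1..} (\<lambda>_. borel)) (\<lambda>\<omega>. \<lambda>i\<in>{1..}. U i \<omega>)"

definition stick_R :: "(nat \<Rightarrow> 'a \<Rightarrow> real) \<Rightarrow> nat \<Rightarrow> 'a \<Rightarrow> real" where
  "stick_R W k \<omega> = 1 - (\<Prod>i=1..k. 1 - W i \<omega>)"

definition stick_I :: "(nat \<Rightarrow> 'a \<Rightarrow> real) \<Rightarrow> nat \<Rightarrow> 'a \<Rightarrow> real set" where
  "stick_I W k \<omega> = {stick_R W (k - 1) \<omega> ..< stick_R W k \<omega>}"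

text \<open>
  The time \<open>n(k,1)\<close>; it is \<open>\<infinity>\<close> on the null event that no sample point falls outside
  \<open>[0, R\<^sub>k)\<close>.
\<close>

definition first_exit ::
    "(nat \<Rightarrow> 'a \<Rightarrow> real) \<Rightarrow> (nat \<Rightarrow> 'a \<Rightarrow> real) \<Rightarrow> nat \<Rightarrow> 'a \<Rightarrow> enat" where
  "first_exit W U k \<omega> = Inf (enat ` {n. 1 \<le> n \<and> U n \<omega> \<notin> {0..<stick_R W k \<omega>}})"

definition renewal_u ::
    "'a measure \<Rightarrow> (nat \<Rightarrow> 'a \<Rightarrow> real) \<Rightarrow> (nat \<Rightarrow> 'a \<Rightarrow> real) \<Rightarrow> nat \<Rightarrow> real" where
  "renewal_u M W U k =
     (if k = 0 then 1
      else measure M {\<omega> \<in> space M. \<forall>i\<in>{1..k}.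
             \<exists>j\<ge>1. enat j < first_exit W U k \<omega> \<and> U j \<omega> \<in> stick_I W i \<omega>})"

text \<open>The Riemann zeta function; only meaningful for \<open>s > 1\<close>, where the series converges.\<close>

definition zeta :: "real \<Rightarrow> real" where
  "zeta s = (\<Sum>n. real (Suc n) powr (- s))"

definition zeta_recurrence :: "(nat \<Rightarrow> real) \<Rightarrow> bool" where
  "zeta_recurrence a \<longleftrightarrow>
     a 0 = 1 \<and> a 1 = 1 / 2 \<and>
     (\<forall>k\<ge>2. 2 * a k + 3 * a (k - 1) + a (k - 2) = 2 * zeta (real k))"

text \<open>The exponent \<open>k - 1\<close> below is \<open>-1\<close> for \<open>k = 0\<close>, hence the integer power.\<close>

definition zeta_closed_form :: "(nat \<Rightarrow> real) \<Rightarrow> bool" where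
  "zeta_closed_form a \<longleftrightarrow>
     (\<forall>k. a k = (-1) powi (int k - 1) * (2 - 3 / 2 ^ k) +
            (\<Sum>j=2..k. (-1) ^ (k - j) * (2 - 1 / 2 ^ (k - j)) * zeta (real j)))"

text \<open>The summation index \<open>j \<ge> 1\<close> is represented as \<open>Suc n\<close>.\<close>

definition series_form :: "(nat \<Rightarrow> real) \<Rightarrow> bool" where
  "series_form a \<longleftrightarrow>
     (\<forall>k. (\<lambda>n. let j = real (Suc n) in 2 / (j ^ k * (j + 1) * (j + 2))) sums a k)"

definition generating_function_form :: "(nat \<Rightarrow> real) \<Rightarrow> bool" where
  "generating_function_form a \<longleftrightarrow>
     (\<forall>z::complex. norm z < 1 \<longrightarrow>
        (\<lambda>k. complex_of_real (a k) * z ^ k) sums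
          (2 / ((1 + z) * (2 + z)) * (1 + (2 - euler_mascheroni - Digamma (1 - z)) * z)))"

end

theory Submission
  imports Defs
begin

text \<open>
  Fix the breaks and write \<open>T\<close> for the length left over after \<open>k\<close> of them. The pieces with index
  in \<open>A\<close> are, up to a null event, all missed before the exit exactly when the first sample point that falls into one of
  them or beyond \<open>R\<^sub>k\<close> falls beyond \<open>R\<^sub>k\<close>; this has probability \<open>Y\<^sub>A = T / (T + (\<Sum>i\<in>A. P\<^sub>i))\<close>
  (\<open>prob_hit_before\<close>). Inclusion-exclusion over \<open>A\<close> (\<open>prob_all_pieces_hit\<close>) and integration
  over the breaks then give \<open>u\<^sub>k\<close> as the alternating sum of the means of the \<open>Y\<^sub>A\<close>.

  Integrating out the last break turns a mean of the \<open>Y\<^sub>A\<close> into a series of higher moments of the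
  shares for the breaks before it, so all moments are carried along: the alternating sums
  \<open>h k m\<close> of \<open>m\<close>-th moments satisfy \<open>h (k + 1) m = (\<Sum>n>m. m / (n * (n + 1)) * h k n)\<close> (\<open>alternating_moment_Suc\<close>).
  There is a Markov chain behind this. Read the pieces from the last to the first and count the
  sample points up to the exit that lie beyond \<open>R\<^sub>i\<close>: the count starts at 1, passes from \<open>m\<close> to
  \<open>n \<ge> m\<close> with probability \<open>m / (n * (n + 1))\<close>, and increases strictly exactly when the piece is hit.
  So \<open>h k m\<close> is the probability that the chain started in \<open>m\<close> makes \<open>k\<close> strict increases in a row,
  and \<open>u\<^sub>k = h k 1\<close>.

  The strict kernel has the eigenfunctions \<open>j! m (m+1)! / (m+1+j)!\<close> with eigenvalues \<open>1 / j\<close>, and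
  these functions sum to the constant 1 (\<open>chain_weight_eigen\<close>, \<open>chain_weight_sums\<close>). Expanding
  \<open>h 0 m = 1\<close> in them yields \<open>h k 1 = (\<Sum>j\<ge>1. 2 / (j^k * (j + 1) * (j + 2)))\<close>, the series of the theorem.

  The remaining descriptions are analysis of this series. Multiplying its terms by
  \<open>2 + 3 j + j\<^sup>2 = (j + 1) * (j + 2)\<close> gives the zeta recurrence, which determines its solution; the
  closed form solves the same recurrence; and exchanging summations turns the generating function
  into a series of partial fractions, which is the digamma series up to telescoping terms. A
  sequence is in turn recovered from its generating function, so all four conditions single out
  the same sequence.
\<close>

section \<open>Double series and telescoping factorial ratios\<close>

text \<open>
  Fubini for double series, for \<open>sums\<close> rather than for unordered sums: the row sums of the
  norms form a summable sequence, so the double family is absolutely summable on the product.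
\<close>

lemma sums_swap_absolutely:
  fixes f :: "nat \<Rightarrow> nat \<Rightarrow> 'b :: banach"
  assumes norms: "\<And>i. (\<lambda>r. norm (f i r)) sums n i" and "summable n"
    and rows: "\<And>i. f i sums a i" and total: "a sums s"
    and columns: "\<And>r. (\<lambda>i. f i r) sums b r"
  shows "b sums s"
proof -
  let ?f = "\<lambda>(i, r). f i r"
  have n_nonneg: "0 \<le> n i" for i
    using sums_le[OF _ sums_zero norms[of i]] by simp
  have abs: "(\<lambda>x. norm (?f x)) summable_on UNIV \<times> UNIV"
  proof (rule summable_on_SigmaI)
    show "((\<lambda>r. norm (?f (i, r))) has_sum n i) UNIV" for i
      using sums_nonneg_imp_has_sum[OF norms] by simp
    show "n summable_on UNIV"
      using summable_nonneg_imp_summable_on_strong[OF \<open>summable n\<close>] n_nonneg by simp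
  qed auto
  then have f: "?f summable_on UNIV \<times> UNIV"
    by (rule abs_summable_summable)
  have "(f i has_sum a i) UNIV" for i
    by (rule norm_summable_imp_has_sum[OF sums_summable[OF norms] rows])
  moreover have na: "norm (a i) \<le> n i" for i
  proof -
    have "norm (a i) = norm (suminf (f i))" using rows[of i] by (simp add: sums_iff)
    also have "\<dots> \<le> (\<Sum>r. norm (f i r))"
      by (rule summable_norm) (use norms[of i] in \<open>simp add: sums_iff\<close>)
    finally show ?thesis using norms[of i] by (simp add: sums_iff)
  qed
  have "summable (\<lambda>i. norm (a i))"
    by (rule summable_comparison_test'[OF \<open>summable n\<close>, of 0]) (use na in auto)
  then have "(a has_sum s) UNIV"
    using total by (rule norm_summable_imp_has_sum)
  ultimately have "(?f has_sum s) (UNIV \<times> UNIV)"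
    using f by (intro has_sum_SigmaI[where g = a]) simp_all
  then have swapped: "((\<lambda>(r, i). f i r) has_sum s) (UNIV \<times> UNIV)"
    by (subst (asm) has_sum_swap) (simp add: case_prod_unfold)
  have "((\<lambda>i. f i r) has_sum b r) UNIV" for r
  proof -
    have "(\<lambda>x. norm ((\<lambda>(r, i). f i r) x)) summable_on UNIV \<times> UNIV"
      using abs by (subst (asm) summable_on_swap) (simp add: case_prod_unfold)
    then have "(\<lambda>(r, i). norm (f i r)) summable_on UNIV \<times> UNIV"
      by (simp add: case_prod_unfold)
    then have "(\<lambda>i. norm (f i r)) summable_on UNIV"
      by (rule summable_on_SigmaD1) simp
    then have "(\<lambda>i. f i r) summable_on UNIV"
      by (rule abs_summable_summable)
    then obtain S where S: "((\<lambda>i. f i r) has_sum S) UNIV"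
      unfolding summable_on_def by blast
    have "S = b r"
      using sums_unique2[OF has_sum_imp_sums[OF S] columns] .
    with S show ?thesis by simp
  qed
  then have "(b has_sum s) UNIV"
    using has_sum_SigmaD[OF swapped, of b] by simp
  then show ?thesis
    by (rule has_sum_imp_sums)
qed

text \<open>
  The terms are the differences of the null sequence \<open>fact (N + r) / fact (N + r + p)\<close>. All
  telescoping series with factorial or polynomial terms below are instances.
\<close>

lemma fact_ratio_sums:
  fixes N p :: nat
  assumes "0 < p"
  shows "(\<lambda>r. real p * (fact (N + r) / fact (N + r + p + 1))) sums (fact N / fact (N + p))"
proof -
  define b :: "nat \<Rightarrow> real" where "b r = fact (N + r) / fact (N + r + p)" for r
  have b_le: "b r \<le> inverse (real (Suc r))" for r
  proof -
    have "(fact (N + r + 1) :: real) \<le> fact (N + r + p)"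
      by (rule fact_mono) (use assms in auto)
    then have "b r \<le> fact (N + r) / fact (N + r + 1)"
      unfolding b_def by (intro divide_left_mono) auto
    also have "\<dots> = inverse (real (N + r + 1))"
      by (subst fact_Suc[of "N + r", simplified Suc_eq_plus1]) (simp add: inverse_eq_divide del: fact_Suc)
    also have "\<dots> \<le> inverse (real (Suc r))"
      by (intro le_imp_inverse_le) auto
    finally show ?thesis .
  qed
  have "b \<longlonglongrightarrow> 0"
    by (rule tendsto_sandwich[OF _ _ tendsto_const LIMSEQ_inverse_real_of_nat])
      (use b_le in \<open>auto simp: b_def simp del: fact_Suc of_nat_Suc\<close>)
  then have "(\<lambda>r. b r - b (Suc r)) sums (b 0 - 0)"
    by (rule telescope_sums')
  moreover have "b r - b (Suc r) = real p * (fact (N + r) / fact (N + r + p + 1))" for r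
  proof -
    have F: "(fact (N + r + p + 1) :: real) = real (N + r + p + 1) * fact (N + r + p)"
      "(fact (N + Suc r) :: real) = real (N + r + 1) * fact (N + r)"
      by simp_all
    have "b r = real (N + r + p + 1) * (fact (N + r) / fact (N + r + p + 1))"
      unfolding b_def F by (simp del: fact_Suc)
    moreover have "b (Suc r) = real (N + r + 1) * (fact (N + r) / fact (N + r + p + 1))"
      unfolding b_def F(2) by (simp del: fact_Suc)
    ultimately show ?thesis
      by (simp only: left_diff_distrib[symmetric]) simp
  qed
  ultimately show ?thesis
    by (simp add: b_def)
qed

section \<open>A Markov chain making strict increases\<close>

text \<open>
  As a function of \<open>m\<close>, this is an eigenfunction of the strict kernel of the chain for the
  eigenvalue \<open>1 / j\<close>; the factor \<open>fact j\<close> makes these functions sum to 1 over \<open>j \<ge> 1\<close>.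
\<close>

definition chain_weight :: "nat \<Rightarrow> nat \<Rightarrow> real" where
  "chain_weight j m = fact j * real m * fact (m + 1) / fact (m + 1 + j)"

lemma chain_weight_sums:
  assumes "1 \<le> m"
  shows "(\<lambda>i. chain_weight (Suc i) m) sums 1"
proof -
  have "(\<lambda>r. fact (m + 1) * (real m * (fact (1 + r) / fact (1 + r + m + 1))))
      sums (fact (m + 1) * (fact 1 / fact (1 + m)))"
    using assms by (intro sums_mult fact_ratio_sums) auto
  moreover have "fact (m + 1) * (real m * (fact (1 + r) / fact (1 + r + m + 1)))
      = chain_weight (Suc r) m" for r
    by (simp add: chain_weight_def add_ac mult_ac del: fact_Suc)
  ultimately show ?thesis
    by (simp add: add_ac del: fact_Suc)
qed

text \<open>
  In state \<open>n = m + r + 1\<close> the factor \<open>n * fact (n + 1)\<close> of the weight cancels the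
  denominator \<open>n * (n + 1)\<close> of the kernel up to \<open>fact n\<close>, and what is left telescopes in \<open>r\<close>.
\<close>

lemma chain_weight_eigen:
  assumes "1 \<le> m" "1 \<le> j"
  shows "(\<lambda>r. real m / (real (m + r + 1) * real (m + r + 2)) * chain_weight j (m + r + 1))
    sums (chain_weight j m / real j)"
proof -
  have "(\<lambda>r. real m * fact j / real j * (real j * (fact (m + 1 + r) / fact (m + 1 + r + j + 1))))
      sums (real m * fact j / real j * (fact (m + 1) / fact (m + 1 + j)))"
    using assms by (intro sums_mult fact_ratio_sums) auto
  moreover have "real m * fact j / real j * (real j * (fact (m + 1 + r) / fact (m + 1 + r + j + 1)))
      = real m / (real (m + r + 1) * real (m + r + 2)) * chain_weight j (m + r + 1)" for r
  proof -
    have "(fact (m + r + 1 + 1) :: real) = real (m + r + 2) * fact (m + r + 1)"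
      by simp
    then have "real m / (real (m + r + 1) * real (m + r + 2)) * chain_weight j (m + r + 1)
      = real m * fact j * (fact (m + r + 1) / fact (m + r + 1 + 1 + j))"
      unfolding chain_weight_def by (simp del: fact_Suc)
    also have "m + r + 1 + 1 + j = m + 1 + r + j + 1" by simp
    finally show ?thesis
      using assms by (simp del: fact_Suc add: add_ac)
  qed
  ultimately show ?thesis
    by (simp add: chain_weight_def mult_ac del: fact_Suc)
qed

text \<open>
  The recursion applies the strict kernel \<open>k\<close> times to the constant 1. Expanding 1 in
  eigenfunctions turns each application into a division by \<open>j\<close>; the exchange of the two
  summations is harmless because all terms are nonnegative.
\<close>

lemma strict_chain_sums:
  fixes h :: "nat \<Rightarrow> nat \<Rightarrow> real"
  assumes base: "\<And>m. 1 \<le> m \<Longrightarrow> h 0 m = 1"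
    and step: "\<And>k m. 1 \<le> m \<Longrightarrow>
      (\<lambda>r. real m / (real (m + r + 1) * real (m + r + 2)) * h k (m + r + 1)) sums h (Suc k) m"
    and "1 \<le> m"
  shows "(\<lambda>i. chain_weight (Suc i) m / real (Suc i) ^ k) sums h k m"
  using \<open>1 \<le> m\<close>
proof (induction k arbitrary: m)
  case 0
  then show ?case using chain_weight_sums base by simp
next
  case (Suc k)
  let ?K = "\<lambda>r. real m / (real (m + r + 1) * real (m + r + 2))"
  let ?f = "\<lambda>r i. ?K r * (chain_weight (Suc i) (m + r + 1) / real (Suc i) ^ k)"
  have rows: "?f r sums (?K r * h k (m + r + 1))" for r
    using Suc.prems by (intro sums_mult Suc.IH) auto
  have nonneg: "norm (?f r i) = ?f r i" for r i
    by (simp add: chain_weight_def del: fact_Suc)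
  show ?case
  proof (rule sums_swap_absolutely)
    show "(\<lambda>i. norm (?f r i)) sums (?K r * h k (m + r + 1))" for r
      using rows[of r] unfolding nonneg .
    show "summable (\<lambda>r. ?K r * h k (m + r + 1))"
      using step[OF Suc.prems] by (rule sums_summable)
    show "(\<lambda>r. ?f r i) sums (chain_weight (Suc i) m / real (Suc i) ^ Suc k)" for i
      using sums_divide[OF chain_weight_eigen[OF Suc.prems, of "Suc i"], of "real (Suc i) ^ k"]
      by (simp add: mult_ac)
  qed (use rows step[OF Suc.prems] in auto)
qed

section \<open>Moments under one uniform break\<close>

abbreviation unif :: "real measure" where
  "unif \<equiv> uniform_measure lborel {0..1}"

lemma prob_space_unif: "prob_space unif"
  by (rule prob_space_uniform_measure) auto

lemma measure_unif:
  assumes "B \<in> sets borel"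
  shows "measure unif B = measure lborel ({0..1} \<inter> B)"
  using assms by (subst measure_uniform_measure) auto

lemma AE_unif: "AE w in unif. w \<in> {0..<1}"
proof (rule AE_uniform_measureI)
  have "AE w in lborel. w \<noteq> (1 :: real)"
    by (rule AE_lborel_singleton)
  then show "AE w in lborel. w \<in> {0..1} \<longrightarrow> w \<in> {0..<1 :: real}"
    by eventually_elim auto
qed auto

lemma nn_integral_unif_Beta:
  "(\<integral>\<^sup>+ w. ennreal ((1 - w) ^ m * w ^ r) \<partial>unif) = ennreal (fact m * fact r / fact (m + r + 1))"
proof -
  have "((\<lambda>t. t powr (real (r + 1) - 1) * (1 - t) powr (real (m + 1) - 1))
      has_integral Beta (real (r + 1)) (real (m + 1))) {0..1}"
    by (rule has_integral_Beta_real) auto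
  then have "((\<lambda>t. (1 - t) ^ m * t ^ r) has_integral Beta (real (r + 1)) (real (m + 1))) {0..1}"
    by (rule has_integral_spike_finite[of "{0, 1}", rotated 2]) (auto simp: powr_realpow)
  moreover have "Beta (real (r + 1)) (real (m + 1)) = fact m * fact r / fact (m + r + 1)"
  proof -
    have "Gamma (real (r + 1)) = fact r" "Gamma (real (m + 1)) = fact m"
      "Gamma (real (r + 1) + real (m + 1)) = fact (m + r + 1)"
      using Gamma_fact[of r, where 'a = real] Gamma_fact[of m, where 'a = real]
        Gamma_fact[of "m + r + 1", where 'a = real]
      by (simp_all add: add_ac del: fact_Suc)
    then show ?thesis by (simp add: Beta_def)
  qed
  ultimately have int: "((\<lambda>t::real. (1 - t) ^ m * t ^ r) has_integral fact m * fact r / fact (m + r + 1)) {0..1}"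
    by simp
  have "(\<integral>\<^sup>+ w. ennreal ((1 - w) ^ m * w ^ r) \<partial>unif)
      = (\<integral>\<^sup>+ w. ennreal ((1 - w) ^ m * w ^ r) * indicator {0..1} w \<partial>lborel)"
    by (subst nn_integral_uniform_measure) (auto simp: divide_ennreal_def)
  also have "\<dots> = (\<integral>\<^sup>+ w. ennreal (if w \<in> {0..1} then (1 - w) ^ m * w ^ r else 0) \<partial>lborel)"
    by (intro nn_integral_cong) (auto simp: indicator_def)
  also have "\<dots> = ennreal (fact m * fact r / fact (m + r + 1))"
  proof (rule nn_integral_has_integral_lborel)
    show "((\<lambda>w :: real. if w \<in> {0..1} then (1 - w) ^ m * w ^ r else 0)
        has_integral fact m * fact r / fact (m + r + 1)) UNIV"
      using int by (subst has_integral_restrict_UNIV)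
  qed auto
  finally show ?thesis .
qed

lemma negative_binomial_sums:
  fixes x :: real
  assumes "1 \<le> m" "0 \<le> x" "x < 1"
  shows "(\<lambda>r. real ((m + r - 1) choose r) * x ^ r) sums (1 / (1 - x) ^ m)"
proof -
  have "(\<lambda>r. ((- real m) gchoose r) * (- x) ^ r) sums (1 + - x) powr (- real m)"
    by (rule gen_binomial_real) (use assms in auto)
  moreover have "((- real m) gchoose r) * (- x) ^ r = real ((m + r - 1) choose r) * x ^ r" for r
  proof -
    have "real m + real r - 1 = real (m + r - 1)"
      using assms by simp
    then have "(- real m) gchoose r = (- 1) ^ r * real ((m + r - 1) choose r)"
      by (simp only: gbinomial_minus[of "real m"] binomial_gbinomial)
    then have "((- real m) gchoose r) * (- x) ^ r
        = ((- 1) ^ r * (- 1) ^ r) * (real ((m + r - 1) choose r) * x ^ r)"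
      by (simp only: power_minus[of x] mult_ac)
    also have "(- 1) ^ r * (- 1) ^ r = (1 :: real)"
      by (simp flip: power_mult_distrib)
    finally show ?thesis by simp
  qed
  moreover have "(1 + - x) powr (- real m) = 1 / (1 - x) ^ m"
    using assms by (simp add: powr_minus powr_realpow field_simps)
  ultimately show ?thesis by simp
qed

text \<open>
  Let \<open>y\<close> be the share of the remaining stick in its union with some of the pieces. If a
  proportion \<open>w\<close> of the stick is broken off and discarded, \<open>y\<close> becomes
  \<open>(1 - w) * y / (1 - w * y)\<close>. The negative binomial expansion in powers of \<open>w * y\<close>, integrated
  term by term with Beta integrals, expresses the mean of the new \<open>m\<close>-th power by the powers of \<open>y\<close> from \<open>m\<close> on.
\<close>

lemma nn_integral_unif_moment_step:
  fixes y :: real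
  assumes "1 \<le> m" "0 \<le> y" "y \<le> 1"
  shows "(\<integral>\<^sup>+ w. ennreal (((1 - w) * y / (1 - w * y)) ^ m) \<partial>unif)
    = (\<Sum>r. ennreal (real m / (real (m + r) * real (m + r + 1)) * y ^ (m + r)))"
proof -
  let ?c = "\<lambda>r. real ((m + r - 1) choose r) * y ^ (m + r)"
  have "ennreal (((1 - w) * y / (1 - w * y)) ^ m) = (\<Sum>r. ennreal (?c r * ((1 - w) ^ m * w ^ r)))"
    if w: "w \<in> {0..<1}" for w
  proof -
    have "w * y \<le> w * 1" using w assms by (intro mult_left_mono) auto
    then have "w * y < 1" using w by simp
    then have "(\<lambda>r. ((1 - w) * y) ^ m * (real ((m + r - 1) choose r) * (w * y) ^ r))
        sums (((1 - w) * y) ^ m * (1 / (1 - w * y) ^ m))"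
      using w assms by (intro sums_mult negative_binomial_sums) auto
    moreover have "((1 - w) * y) ^ m * (real ((m + r - 1) choose r) * (w * y) ^ r)
        = ?c r * ((1 - w) ^ m * w ^ r)" for r
      by (simp add: power_mult_distrib power_add mult_ac)
    ultimately have "(\<lambda>r. ?c r * ((1 - w) ^ m * w ^ r)) sums (((1 - w) * y / (1 - w * y)) ^ m)"
      by (simp only: power_divide mult_1_right times_divide_eq_right)
    then show ?thesis
      using w assms by (subst suminf_ennreal_eq) (auto intro!: mult_nonneg_nonneg)
  qed
  then have "(\<integral>\<^sup>+ w. ennreal (((1 - w) * y / (1 - w * y)) ^ m) \<partial>unif)
      = (\<integral>\<^sup>+ w. (\<Sum>r. ennreal (?c r * ((1 - w) ^ m * w ^ r))) \<partial>unif)"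
    using AE_unif by (intro nn_integral_cong_AE) (auto elim: eventually_mono)
  also have "\<dots> = (\<Sum>r. \<integral>\<^sup>+ w. ennreal (?c r * ((1 - w) ^ m * w ^ r)) \<partial>unif)"
    by (rule nn_integral_suminf) measurable
  also have "\<dots> = (\<Sum>r. ennreal (real m / (real (m + r) * real (m + r + 1)) * y ^ (m + r)))"
  proof (rule suminf_cong)
    fix r
    have "(\<integral>\<^sup>+ w. ennreal (?c r * ((1 - w) ^ m * w ^ r)) \<partial>unif)
        = (\<integral>\<^sup>+ w. ennreal (?c r) * ennreal ((1 - w) ^ m * w ^ r) \<partial>unif)"
      using assms by (simp add: ennreal_mult')
    also have "\<dots> = ennreal (?c r) * ennreal (fact m * fact r / fact (m + r + 1))"
      by (subst nn_integral_cmult) (simp_all add: nn_integral_unif_Beta)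
    also have "\<dots> = ennreal (?c r * (fact m * fact r / fact (m + r + 1)))"
      by (rule ennreal_mult[symmetric]) (use assms in auto)
    also have "?c r * (fact m * fact r / fact (m + r + 1))
        = real m / (real (m + r) * real (m + r + 1)) * y ^ (m + r)"
    proof -
      obtain q where q: "m = Suc q" using assms by (cases m) auto
      have "real ((q + r) choose r) = fact (q + r) / (fact r * fact q)"
        by (simp add: binomial_fact)
      moreover have "(fact m :: real) = real m * fact q"
        "(fact (m + r + 1) :: real) = real (m + r + 1) * (real (m + r) * fact (q + r))"
        unfolding q by simp_all
      ultimately show ?thesis
        by (simp add: q mult_ac del: fact_Suc)
    qed
    finally show "(\<integral>\<^sup>+ w. ennreal (?c r * ((1 - w) ^ m * w ^ r)) \<partial>unif)
        = ennreal (real m / (real (m + r) * real (m + r + 1)) * y ^ (m + r))" .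
  qed
  finally show ?thesis .
qed

section \<open>The share of the remaining stick\<close>

definition tail_length :: "nat \<Rightarrow> (nat \<Rightarrow> real) \<Rightarrow> real" where
  "tail_length k w = (\<Prod>i=1..k. 1 - w i)"

definition piece :: "nat \<Rightarrow> (nat \<Rightarrow> real) \<Rightarrow> real" where
  "piece i w = w i * tail_length (i - 1) w"

text \<open>
  Given the breaks \<open>w\<close>, this is the conditional probability that no piece with index in \<open>A\<close> is
  hit before a sample point falls into the remaining stick.
\<close>

definition tail_share :: "nat set \<Rightarrow> nat \<Rightarrow> (nat \<Rightarrow> real) \<Rightarrow> real" where
  "tail_share A k w = tail_length k w / (tail_length k w + (\<Sum>i\<in>A \<inter> {1..k}. piece i w))"

lemma tail_length_0 [simp]: "tail_length 0 w = 1"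
  by (simp add: tail_length_def)

lemma tail_length_Suc: "tail_length (Suc k) w = (1 - w (Suc k)) * tail_length k w"
  by (simp add: tail_length_def)

lemma tail_share_0 [simp]: "tail_share A 0 w = 1"
  by (simp add: tail_share_def)

lemma tail_length_cong:
  "(\<And>i. i \<in> {1..k} \<Longrightarrow> w i = w' i) \<Longrightarrow> tail_length k w = tail_length k w'"
  unfolding tail_length_def by (rule prod.cong) auto

lemma tail_share_cong:
  assumes "\<And>i. i \<in> {1..k} \<Longrightarrow> w i = w' i"
  shows "tail_share A k w = tail_share A k w'"
proof -
  have "piece i w = piece i w'" if "i \<in> {1..k}" for i
    unfolding piece_def using that assms by (auto intro!: tail_length_cong arg_cong2[where f = "(*)"])
  then show ?thesis
    unfolding tail_share_def using assms tail_length_cong[of k w w'] by (auto intro!: sum.cong)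
qed

lemma tail_length_pos:
  assumes "\<And>i. i \<in> {1..k} \<Longrightarrow> w i \<in> {0..<1}"
  shows "0 < tail_length k w"
  unfolding tail_length_def using assms by (intro prod_pos) auto

lemma piece_nonneg:
  assumes "\<And>i. i \<in> {1..k} \<Longrightarrow> w i \<in> {0..<1}" "i \<in> {1..k}"
  shows "0 \<le> piece i w"
  unfolding piece_def using assms by (intro mult_nonneg_nonneg less_imp_le[OF tail_length_pos]) auto

lemma tail_share_bounds:
  assumes "\<And>i. i \<in> {1..k} \<Longrightarrow> w i \<in> {0..<1}"
  shows "0 \<le> tail_share A k w" and "tail_share A k w \<le> 1"
proof -
  have "0 \<le> (\<Sum>i\<in>A \<inter> {1..k}. piece i w)"
    by (intro sum_nonneg) (auto intro: piece_nonneg[OF assms])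
  then show "0 \<le> tail_share A k w" "tail_share A k w \<le> 1"
    using tail_length_pos[of k w] assms by (simp_all add: tail_share_def)
qed

text \<open>
  The next break only takes its piece from the remaining stick. The piece stays in the
  denominator if its index belongs to \<open>A\<close>, and is lost from the denominator otherwise.
\<close>

lemma tail_share_Suc:
  assumes w: "\<And>i. i \<in> {1..k} \<Longrightarrow> w i \<in> {0..<1}"
  shows "tail_share A (Suc k) w =
    (if Suc k \<in> A then (1 - w (Suc k)) * tail_share A k w
     else (1 - w (Suc k)) * tail_share A k w / (1 - w (Suc k) * tail_share A k w))"
proof -
  define S where "S = (\<Sum>i\<in>A \<inter> {1..k}. piece i w)"
  define T where "T = tail_length k w"
  have "0 \<le> S"
    unfolding S_def by (intro sum_nonneg) (auto intro: piece_nonneg[OF w])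
  moreover have "0 < T"
    unfolding T_def by (rule tail_length_pos[OF w])
  ultimately have TS: "T + S \<noteq> 0" by simp
  have share: "tail_share A k w = T / (T + S)"
    by (simp add: tail_share_def T_def S_def)
  show ?thesis
  proof (cases "Suc k \<in> A")
    case True
    then have "A \<inter> {1..Suc k} = insert (Suc k) (A \<inter> {1..k})" by auto
    then have "(\<Sum>i\<in>A \<inter> {1..Suc k}. piece i w) = w (Suc k) * T + S"
      by (simp add: S_def T_def piece_def)
    then have "tail_share A (Suc k) w = (1 - w (Suc k)) * T / ((1 - w (Suc k)) * T + (w (Suc k) * T + S))"
      by (simp add: tail_share_def tail_length_Suc T_def)
    also have "(1 - w (Suc k)) * T + (w (Suc k) * T + S) = T + S"
      by (simp add: algebra_simps)
    finally show ?thesis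
      using True share by simp
  next
    case False
    then have "A \<inter> {1..Suc k} = A \<inter> {1..k}"
      by (auto simp: le_Suc_eq)
    then have "tail_share A (Suc k) w = (1 - w (Suc k)) * T / ((1 - w (Suc k)) * T + S)"
      by (simp add: tail_share_def tail_length_Suc T_def S_def)
    also have "\<dots> = ((1 - w (Suc k)) * T / (T + S)) / (((1 - w (Suc k)) * T + S) / (T + S))"
      using TS by simp
    also have "((1 - w (Suc k)) * T + S) / (T + S) = 1 - w (Suc k) * (T / (T + S))"
      using TS by (simp add: field_simps)
    finally show ?thesis
      using False share by simp
  qed
qed

lemma measurable_tail_length [measurable]:
  "k \<le> n \<Longrightarrow> tail_length k \<in> borel_measurable (PiM {1..n} (\<lambda>_. unif))"
  unfolding tail_length_def by (intro borel_measurable_prod borel_measurable_diff) auto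

lemma measurable_piece [measurable]:
  "i \<in> {1..n} \<Longrightarrow> piece i \<in> borel_measurable (PiM {1..n} (\<lambda>_. unif))"
  unfolding piece_def by (intro borel_measurable_times measurable_tail_length) auto

lemma measurable_tail_share [measurable]:
  "tail_share A k \<in> borel_measurable (PiM {1..k} (\<lambda>_. unif))"
  unfolding tail_share_def
  by (intro borel_measurable_divide borel_measurable_add borel_measurable_sum measurable_tail_length
      measurable_piece) auto

lemma AE_PiM_unif: "AE w in PiM {1..k :: nat} (\<lambda>_. unif). \<forall>i\<in>{1..k}. w i \<in> {0..<1}"
proof -
  interpret U: prob_space unif by (rule prob_space_unif)
  interpret P: product_prob_space "\<lambda>_::nat. unif" "{1..k}" ..
  show ?thesis
    by (rule AE_finite_allI) (auto intro!: P.AE_component AE_unif simp del: atLeastLessThan_iff)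
qed

text \<open>
  An extended nonnegative integral, so that iterated integration and termwise integration of
  series need no integrability conditions.
\<close>

definition share_moment :: "nat set \<Rightarrow> nat \<Rightarrow> nat \<Rightarrow> ennreal" where
  "share_moment A k m = (\<integral>\<^sup>+ w. ennreal (tail_share A k w ^ m) \<partial>PiM {1..k} (\<lambda>_. unif))"

lemma share_moment_0: "share_moment A 0 m = 1"
proof -
  interpret P: prob_space "PiM ({} :: nat set) (\<lambda>_. unif)"
    by (intro prob_space_PiM prob_space_unif)
  show ?thesis using P.emeasure_space_1 by (simp add: share_moment_def)
qed

lemma share_moment_Suc:
  "share_moment A (Suc k) m =
    (\<integral>\<^sup>+ w. \<integral>\<^sup>+ v. ennreal ((if Suc k \<in> A then (1 - v) * tail_share A k w
       else (1 - v) * tail_share A k w / (1 - v * tail_share A k w)) ^ m) \<partial>unif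
      \<partial>PiM {1..k} (\<lambda>_. unif))"
proof -
  interpret U: prob_space unif by (rule prob_space_unif)
  interpret P: product_prob_space "\<lambda>_::nat. unif" "{1..k}" ..
  have ins: "{1..Suc k} = insert (Suc k) {1..k}" by auto
  have meas: "(\<lambda>w. ennreal (tail_share A (Suc k) w ^ m))
      \<in> borel_measurable (PiM (insert (Suc k) {1..k}) (\<lambda>_. unif))"
    unfolding ins[symmetric] by measurable
  have "share_moment A (Suc k) m = (\<integral>\<^sup>+ w. \<integral>\<^sup>+ v. ennreal (tail_share A (Suc k) (w(Suc k := v)) ^ m) \<partial>unif
      \<partial>PiM {1..k} (\<lambda>_. unif))"
    unfolding share_moment_def ins by (subst P.product_nn_integral_insert[OF _ _ meas]) auto
  also have "\<dots> = (\<integral>\<^sup>+ w. \<integral>\<^sup>+ v. ennreal ((if Suc k \<in> A then (1 - v) * tail_share A k w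
       else (1 - v) * tail_share A k w / (1 - v * tail_share A k w)) ^ m) \<partial>unif
      \<partial>PiM {1..k} (\<lambda>_. unif))"
  proof (rule nn_integral_cong_AE, rule eventually_mono[OF AE_PiM_unif])
    fix w :: "nat \<Rightarrow> real"
    assume w: "\<forall>i\<in>{1..k}. w i \<in> {0..<1}"
    have "tail_share A k (w(Suc k := v)) = tail_share A k w" for v
      by (rule tail_share_cong) auto
    then have "tail_share A (Suc k) (w(Suc k := v)) = (if Suc k \<in> A then (1 - v) * tail_share A k w
       else (1 - v) * tail_share A k w / (1 - v * tail_share A k w))" for v
      using w by (subst tail_share_Suc) auto
    then show "(\<integral>\<^sup>+ v. ennreal (tail_share A (Suc k) (w(Suc k := v)) ^ m) \<partial>unif) =
      (\<integral>\<^sup>+ v. ennreal ((if Suc k \<in> A then (1 - v) * tail_share A k w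
       else (1 - v) * tail_share A k w / (1 - v * tail_share A k w)) ^ m) \<partial>unif)"
      by simp
  qed
  finally show ?thesis .
qed

lemma share_moment_Suc_mem:
  assumes "Suc k \<in> A"
  shows "share_moment A (Suc k) m = ennreal (1 / real (m + 1)) * share_moment A k m"
proof -
  have "share_moment A (Suc k) m =
     (\<integral>\<^sup>+ w. \<integral>\<^sup>+ v. ennreal (((1 - v) * tail_share A k w) ^ m) \<partial>unif \<partial>PiM {1..k} (\<lambda>_. unif))"
    using assms by (simp add: share_moment_Suc)
  also have "\<dots> = (\<integral>\<^sup>+ w. ennreal (1 / real (m + 1)) * ennreal (tail_share A k w ^ m) \<partial>PiM {1..k} (\<lambda>_. unif))"
  proof (rule nn_integral_cong_AE, rule eventually_mono[OF AE_PiM_unif])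
    fix w :: "nat \<Rightarrow> real"
    assume w: "\<forall>i\<in>{1..k}. w i \<in> {0..<1}"
    have "(\<integral>\<^sup>+ v. ennreal (((1 - v) * tail_share A k w) ^ m) \<partial>unif)
      = (\<integral>\<^sup>+ v. ennreal (tail_share A k w ^ m) * ennreal ((1 - v) ^ m * v ^ 0) \<partial>unif)"
      using tail_share_bounds[of k w A] w
      by (intro nn_integral_cong) (simp add: power_mult_distrib ennreal_mult'' mult.commute flip: ennreal_mult')
    also have "\<dots> = ennreal (tail_share A k w ^ m) * ennreal (fact m * fact 0 / fact (m + 0 + 1))"
      by (subst nn_integral_cmult) (simp_all only: nn_integral_unif_Beta, measurable)
    also have "fact m * fact 0 / fact (m + 0 + 1) = 1 / real (m + 1)"
      by simp
    finally show "(\<integral>\<^sup>+ v. ennreal (((1 - v) * tail_share A k w) ^ m) \<partial>unif)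
        = ennreal (1 / real (m + 1)) * ennreal (tail_share A k w ^ m)"
      by (simp add: mult.commute)
  qed
  also have "\<dots> = ennreal (1 / real (m + 1)) * share_moment A k m"
    unfolding share_moment_def by (rule nn_integral_cmult) measurable
  finally show ?thesis .
qed

lemma share_moment_Suc_notmem:
  assumes "Suc k \<notin> A" "1 \<le> m"
  shows "share_moment A (Suc k) m =
    (\<Sum>r. ennreal (real m / (real (m + r) * real (m + r + 1))) * share_moment A k (m + r))"
proof -
  let ?c = "\<lambda>r. real m / (real (m + r) * real (m + r + 1))"
  have "share_moment A (Suc k) m =
     (\<integral>\<^sup>+ w. \<integral>\<^sup>+ v. ennreal (((1 - v) * tail_share A k w / (1 - v * tail_share A k w)) ^ m) \<partial>unif
       \<partial>PiM {1..k} (\<lambda>_. unif))"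
    using assms by (simp add: share_moment_Suc)
  also have "\<dots> = (\<integral>\<^sup>+ w. (\<Sum>r. ennreal (?c r) * ennreal (tail_share A k w ^ (m + r))) \<partial>PiM {1..k} (\<lambda>_. unif))"
  proof (rule nn_integral_cong_AE, rule eventually_mono[OF AE_PiM_unif])
    fix w :: "nat \<Rightarrow> real"
    assume w: "\<forall>i\<in>{1..k}. w i \<in> {0..<1}"
    have bounds: "0 \<le> tail_share A k w" "tail_share A k w \<le> 1"
      using tail_share_bounds[of k w A] w by auto
    have "(\<integral>\<^sup>+ v. ennreal (((1 - v) * tail_share A k w / (1 - v * tail_share A k w)) ^ m) \<partial>unif)
        = (\<Sum>r. ennreal (?c r * tail_share A k w ^ (m + r)))"
      using assms(2) bounds by (rule nn_integral_unif_moment_step)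
    also have "\<dots> = (\<Sum>r. ennreal (?c r) * ennreal (tail_share A k w ^ (m + r)))"
      using bounds by (intro suminf_cong ennreal_mult) auto
    finally show "(\<integral>\<^sup>+ v. ennreal (((1 - v) * tail_share A k w / (1 - v * tail_share A k w)) ^ m) \<partial>unif)
        = (\<Sum>r. ennreal (?c r) * ennreal (tail_share A k w ^ (m + r)))" .
  qed
  also have "\<dots> = (\<Sum>r. \<integral>\<^sup>+ w. ennreal (?c r) * ennreal (tail_share A k w ^ (m + r)) \<partial>PiM {1..k} (\<lambda>_. unif))"
    by (rule nn_integral_suminf) measurable
  also have "\<dots> = (\<Sum>r. ennreal (?c r) * share_moment A k (m + r))"
    unfolding share_moment_def by (intro suminf_cong nn_integral_cmult) measurable
  finally show ?thesis .
qed

lemma share_moment_cong: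
  "A \<inter> {1..k} = B \<inter> {1..k} \<Longrightarrow> share_moment A k m = share_moment B k m"
  by (simp add: share_moment_def tail_share_def)

lemma share_moment_le_1: "share_moment A k m \<le> 1"
proof -
  interpret P: prob_space "PiM {1..k} (\<lambda>_. unif)"
    by (intro prob_space_PiM prob_space_unif)
  have "share_moment A k m \<le> (\<integral>\<^sup>+ w. 1 \<partial>PiM {1..k} (\<lambda>_. unif))"
    unfolding share_moment_def
  proof (rule nn_integral_mono_AE, rule eventually_mono[OF AE_PiM_unif])
    fix w :: "nat \<Rightarrow> real"
    assume w: "\<forall>i\<in>{1..k}. w i \<in> {0..<1}"
    then have "tail_share A k w ^ m \<le> 1"
      using tail_share_bounds[of k w A] by (intro power_le_one) auto
    then show "ennreal (tail_share A k w ^ m) \<le> 1"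
      by simp
  qed
  then show ?thesis
    using P.emeasure_space_1 by simp
qed

definition alternating_moment :: "nat \<Rightarrow> nat \<Rightarrow> real" where
  "alternating_moment k m = (\<Sum>A\<in>Pow {1..k}. (- 1) ^ card A * enn2real (share_moment A k m))"

lemma alternating_moment_0: "alternating_moment 0 m = 1"
  by (simp add: alternating_moment_def share_moment_0)

text \<open>
  The sets \<open>A\<close> and \<open>insert (Suc k) A\<close> occur with opposite signs. The moment for the latter is
  exactly the diagonal term of the series for the former, which leaves the strict part of the
  kernel. In the chain, this subtracts the event that the new piece is missed.
\<close>

lemma alternating_moment_Suc:
  assumes "1 \<le> m"
  shows "(\<lambda>r. real m / (real (m + r + 1) * real (m + r + 2)) * alternating_moment k (m + r + 1))
    sums alternating_moment (Suc k) m"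
proof -
  let ?c = "\<lambda>r. real m / (real (m + r) * real (m + r + 1))"
  let ?e = "\<lambda>A k m. enn2real (share_moment A k m)"
  have fin: "share_moment A k m < \<top>" for A k m
    using share_moment_le_1[of A k m] by (rule le_less_trans) simp
  have sums_A: "(\<lambda>r. ?c (Suc r) * ?e A k (m + Suc r)) sums (?e A (Suc k) m - ?e (insert (Suc k) A) (Suc k) m)"
    if A: "A \<subseteq> {1..k}" for A
  proof -
    have "(\<Sum>r. ennreal (?c r * ?e A k (m + r))) = (\<Sum>r. ennreal (?c r) * share_moment A k (m + r))"
      by (intro suminf_cong) (simp only: ennreal_mult'' enn2real_nonneg ennreal_enn2real[OF fin])
    also have "\<dots> = share_moment A (Suc k) m"
      using A assms by (intro share_moment_Suc_notmem[symmetric]) auto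
    also have "\<dots> = ennreal (?e A (Suc k) m)"
      using fin by simp
    finally have "(\<lambda>r. ennreal (?c r * ?e A k (m + r))) sums ennreal (?e A (Suc k) m)"
      by (subst sums_iff) simp
    then have "(\<lambda>r. ?c r * ?e A k (m + r)) sums ?e A (Suc k) m"
      by (subst (asm) sums_ennreal) auto
    then have "(\<lambda>r. ?c (Suc r) * ?e A k (m + Suc r)) sums (?e A (Suc k) m - ?c 0 * ?e A k (m + 0))"
      by (subst sums_Suc_iff) simp
    moreover have "?e (insert (Suc k) A) (Suc k) m = ?c 0 * ?e A k (m + 0)"
    proof -
      have "share_moment (insert (Suc k) A) k m = share_moment A k m"
        by (rule share_moment_cong) auto
      then show ?thesis
        using assms by (simp add: share_moment_Suc_mem enn2real_mult)
    qed
    ultimately show ?thesis by simp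
  qed
  have "(\<lambda>r. \<Sum>A\<in>Pow {1..k}. (- 1) ^ card A * (?c (Suc r) * ?e A k (m + Suc r)))
      sums (\<Sum>A\<in>Pow {1..k}. (- 1) ^ card A * (?e A (Suc k) m - ?e (insert (Suc k) A) (Suc k) m))"
    by (intro sums_sum sums_mult sums_A) auto
  also have "(\<lambda>r. \<Sum>A\<in>Pow {1..k}. (- 1) ^ card A * (?c (Suc r) * ?e A k (m + Suc r))) =
      (\<lambda>r. real m / (real (m + r + 1) * real (m + r + 2)) * alternating_moment k (m + r + 1))"
    by (simp add: alternating_moment_def sum_distrib_left mult_ac)
  also have "(\<Sum>A\<in>Pow {1..k}. (- 1) ^ card A * (?e A (Suc k) m - ?e (insert (Suc k) A) (Suc k) m))
      = alternating_moment (Suc k) m"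
  proof -
    have ins: "{1..Suc k} = insert (Suc k) {1..k}" by auto
    have "inj_on (insert (Suc k)) (Pow {1..k})"
      by (auto simp: inj_on_def)
         (metis Suc_n_not_le_n atLeastAtMost_iff insertE insert_iff subset_eq)+
    then have "(\<Sum>B\<in>insert (Suc k) ` Pow {1..k}. (- 1) ^ card B * ?e B (Suc k) m)
        = (\<Sum>A\<in>Pow {1..k}. (- 1) ^ card (insert (Suc k) A) * ?e (insert (Suc k) A) (Suc k) m)"
      by (simp add: sum.reindex)
    also have "\<dots> = (\<Sum>A\<in>Pow {1..k}. - ((- 1) ^ card A * ?e (insert (Suc k) A) (Suc k) m))"
    proof (rule sum.cong)
      fix A assume "A \<in> Pow {1..k}"
      then have "finite A" "Suc k \<notin> A" by (auto intro: finite_subset)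
      then show "(- 1) ^ card (insert (Suc k) A) * ?e (insert (Suc k) A) (Suc k) m
          = - ((- 1) ^ card A * ?e (insert (Suc k) A) (Suc k) m)" by simp
    qed simp
    finally have "alternating_moment (Suc k) m = (\<Sum>A\<in>Pow {1..k}. (- 1) ^ card A * ?e A (Suc k) m)
        + (\<Sum>A\<in>Pow {1..k}. - ((- 1) ^ card A * ?e (insert (Suc k) A) (Suc k) m))"
      unfolding alternating_moment_def ins Pow_insert
      by (subst sum.union_disjoint) auto
    then show ?thesis
      by (simp add: sum.distrib[symmetric] right_diff_distrib)
  qed
  finally show ?thesis .
qed

section \<open>Hitting all pieces of a fixed partition\<close>

text \<open>
  Inclusion-exclusion for the complement of a union: expand the product of \<open>1 - indicator (N i)\<close>
  and integrate.
\<close>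

lemma (in prob_space) prob_avoid_all:
  assumes "finite I" and N: "\<And>i. i \<in> I \<Longrightarrow> N i \<in> events"
  shows "prob {x \<in> space M. \<forall>i\<in>I. x \<notin> N i}
    = (\<Sum>A\<in>Pow I. (- 1) ^ card A * prob {x \<in> space M. \<forall>i\<in>A. x \<in> N i})"
proof -
  have meas: "{x \<in> space M. \<forall>i\<in>A. x \<in> N i} \<in> events" if "A \<subseteq> I" for A
  proof (rule sets.sets_Collect_finite_All)
    show "finite A" using that \<open>finite I\<close> by (rule finite_subset)
    fix i assume "i \<in> A"
    then have "N i \<in> events" using that N by auto
    moreover from this have "{x \<in> space M. x \<in> N i} = N i"
      using sets.sets_into_space by auto
    ultimately show "{x \<in> space M. x \<in> N i} \<in> events" by simp
  qed
  have meas': "{x \<in> space M. \<forall>i\<in>I. x \<notin> N i} \<in> events"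
  proof (rule sets.sets_Collect_finite_All)
    fix i assume "i \<in> I"
    moreover have "{x \<in> space M. x \<notin> N i} = space M - N i" by auto
    ultimately show "{x \<in> space M. x \<notin> N i} \<in> events" using N by auto
  qed fact
  have prod_ind: "(\<Prod>i\<in>A. indicator (N i) x) = (indicator {x \<in> space M. \<forall>i\<in>A. x \<in> N i} x :: real)"
    if "A \<subseteq> I" "x \<in> space M" for A x
    using finite_subset[OF that(1) \<open>finite I\<close>] that(2)
    by (induction A rule: finite_induct) (auto simp: indicator_def)
  have "indicator {x \<in> space M. \<forall>i\<in>I. x \<notin> N i} x = (\<Prod>i\<in>I. 1 - indicator (N i) x :: real)"
    if "x \<in> space M" for x
    using \<open>finite I\<close> that by (induction I rule: finite_induct) (auto simp: indicator_def)
  moreover have "(\<Prod>i\<in>I. 1 - indicator (N i) x :: real)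
      = (\<Sum>A\<in>Pow I. (- 1) ^ card A * indicator {x \<in> space M. \<forall>i\<in>A. x \<in> N i} x)"
    if "x \<in> space M" for x
    using that by (subst prod_diff_conv_sum[OF \<open>finite I\<close>]) (auto intro!: sum.cong simp: prod_ind)
  ultimately have ind: "indicator {x \<in> space M. \<forall>i\<in>I. x \<notin> N i} x
      = (\<Sum>A\<in>Pow I. (- 1) ^ card A * indicator {x \<in> space M. \<forall>i\<in>A. x \<in> N i} x :: real)"
    if "x \<in> space M" for x
    using that by simp
  have "prob {x \<in> space M. \<forall>i\<in>I. x \<notin> N i}
      = (\<integral>x. indicator {x \<in> space M. \<forall>i\<in>I. x \<notin> N i} x \<partial>M)"
    using meas' by simp
  also have "\<dots> = (\<integral>x. (\<Sum>A\<in>Pow I. (- 1) ^ card A * indicator {x \<in> space M. \<forall>i\<in>A. x \<in> N i} x) \<partial>M)"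
    by (rule Bochner_Integration.integral_cong[OF refl ind])
  also have "\<dots> = (\<Sum>A\<in>Pow I. \<integral>x. (- 1) ^ card A * indicator {x \<in> space M. \<forall>i\<in>A. x \<in> N i} x \<partial>M)"
    using meas by (intro Bochner_Integration.integral_sum integrable_mult_right integrable_real_indicator)
      (auto simp: emeasure_eq_measure)
  also have "\<dots> = (\<Sum>A\<in>Pow I. (- 1) ^ card A * prob {x \<in> space M. \<forall>i\<in>A. x \<in> N i})"
    using meas by (intro sum.cong) auto
  finally show ?thesis .
qed

text \<open>
  Let \<open>c\<close> and \<open>q\<close> be the measures of \<open>C\<close> and \<open>J\<close>. The first sample point in \<open>C \<union> J\<close> lies in \<open>C\<close> with probability \<open>c / (c + q)\<close> and in \<open>J\<close> with
  probability \<open>q / (c + q)\<close>, by summing a geometric series over the time of that point. The former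
  event implies the one in question and the latter excludes it. The resulting lower and upper
  bounds agree, which absorbs the null event that \<open>C \<union> J\<close> is never visited.
\<close>

lemma prob_hit_before:
  fixes \<nu> :: "real measure" and C J :: "real set"
  defines "P \<equiv> PiM {1..} (\<lambda>_ :: nat. \<nu>)"
  assumes "prob_space \<nu>" and C: "C \<in> sets \<nu>" and J: "J \<in> sets \<nu>" and "C \<inter> J = {}"
    and pos: "0 < measure \<nu> C + measure \<nu> J"
  shows "measure P {x \<in> space P. \<forall>j\<ge>1. x j \<in> J \<longrightarrow> (\<exists>l\<in>{1..j}. x l \<in> C)}
    = measure \<nu> C / (measure \<nu> C + measure \<nu> J)"
proof -
  interpret \<nu>: prob_space \<nu> by fact
  interpret Pr: product_prob_space "\<lambda>_. \<nu>" "{1..} :: nat set" ..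
  interpret P: prob_space P
    unfolding P_def by (intro prob_space_PiM \<open>prob_space \<nu>\<close>)
  define c q where "c = measure \<nu> C" and "q = measure \<nu> J"
  let ?N = "{x \<in> space P. \<forall>j\<ge>1. x j \<in> J \<longrightarrow> (\<exists>l\<in>{1..j}. x l \<in> C)}"
  (* Here n + 1 is the time of the first point in the union of C and J, and that point lies in B. *)
  define D where "D B n = {x \<in> space P. \<forall>i\<in>{1..Suc n}. x i \<in> (if i = Suc n then B else space \<nu> - (C \<union> J))}"
    for B and n :: nat
  have un: "measure \<nu> (C \<union> J) = c + q"
    unfolding c_def q_def using C J \<open>C \<inter> J = {}\<close> by (rule \<nu>.finite_measure_Union)
  have cq: "0 < c + q" "c + q \<le> 1"
    using pos un \<nu>.prob_le_1[of "C \<union> J"] by (auto simp: c_def q_def)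
  have D_meas: "D B n \<in> sets P" if "B \<in> sets \<nu>" for B n
    unfolding D_def P_def
  proof (rule sets.sets_Collect_finite_All)
    fix i assume "i \<in> {1..Suc n}"
    moreover have "(if i = Suc n then B else space \<nu> - (C \<union> J)) \<in> sets \<nu>"
      using that C J by auto
    ultimately show "{x \<in> space (PiM {1..} (\<lambda>_. \<nu>)). x i \<in> (if i = Suc n then B else space \<nu> - (C \<union> J))}
        \<in> sets (PiM {1..} (\<lambda>_. \<nu>))"
      by (intro sets_Collect_single) auto
  qed simp
  have D_prob: "measure P (D B n) = (1 - (c + q)) ^ n * measure \<nu> B" if B: "B \<in> sets \<nu>" for B n
  proof -
    have "emeasure P (D B n) = (\<Prod>i\<in>{1..Suc n}. emeasure \<nu> (if i = Suc n then B else space \<nu> - (C \<union> J)))"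
      unfolding D_def P_def using B C J by (intro Pr.emeasure_PiM_Collect) auto
    also have "\<dots> = ennreal (\<Prod>i\<in>{1..Suc n}. measure \<nu> (if i = Suc n then B else space \<nu> - (C \<union> J)))"
      unfolding \<nu>.emeasure_eq_measure by (rule prod_ennreal) simp
    finally have "measure P (D B n) = (\<Prod>i\<in>{1..Suc n}. measure \<nu> (if i = Suc n then B else space \<nu> - (C \<union> J)))"
      by (simp add: measure_def prod_nonneg)
    also have "\<dots> = measure \<nu> B * (\<Prod>i\<in>{1..n}. measure \<nu> (space \<nu> - (C \<union> J)))"
      by (simp add: atLeastAtMostSuc_conv)
    also have "measure \<nu> (space \<nu> - (C \<union> J)) = 1 - (c + q)"
      using C J un by (subst \<nu>.prob_compl) auto
    finally show ?thesis by (simp add: mult.commute)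
  qed
  have D_union: "measure P (\<Union>n. D B n) = measure \<nu> B / (c + q)"
    if B: "B \<in> sets \<nu>" "B \<subseteq> C \<union> J" for B
  proof -
    have "disjoint_family (D B)"
    proof (unfold disjoint_family_on_def, intro ballI impI, rule ccontr)
      fix m n :: nat assume "m \<noteq> n" "D B m \<inter> D B n \<noteq> {}"
      then obtain a b x where ab: "a < b" "x \<in> D B a" "x \<in> D B b"
        by (metis disjoint_iff linorder_neqE_nat)
      from ab(2) have "x (Suc a) \<in> B"
        unfolding D_def by (auto dest!: bspec[where x = "Suc a"])
      moreover from ab(1,3) have "x (Suc a) \<notin> C \<union> J"
        unfolding D_def by (auto dest!: bspec[where x = "Suc a"])
      ultimately show False using B(2) by auto
    qed
    then have "(\<lambda>n. measure P (D B n)) sums measure P (\<Union>n. D B n)"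
      using D_meas[OF B(1)] by (intro P.finite_measure_UNION) auto
    moreover have "(\<lambda>n. (1 - (c + q)) ^ n * measure \<nu> B) sums (1 / (1 - (1 - (c + q))) * measure \<nu> B)"
      using cq by (intro sums_mult2 geometric_sums) auto
    ultimately show ?thesis
      using sums_unique2 by (fastforce simp: D_prob[OF B(1)])
  qed
  have N_meas: "?N \<in> sets P"
    unfolding P_def using C J by measurable
  have "c / (c + q) \<le> measure P ?N"
  proof -
    have "measure P (\<Union>n. D C n) \<le> measure P ?N"
    proof (rule P.finite_measure_mono[OF _ N_meas], rule subsetI)
      fix x assume "x \<in> (\<Union>n. D C n)"
      then obtain n where x: "x \<in> space P" "x (Suc n) \<in> C" "\<And>i. i \<in> {1..n} \<Longrightarrow> x i \<notin> J"
        by (force simp: D_def)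
      have "\<exists>l\<in>{1..j}. x l \<in> C" if "j \<ge> 1" "x j \<in> J" for j
      proof -
        have "Suc n \<le> j" using x(3)[of j] that by force
        then show ?thesis using x(2) by (intro bexI[of _ "Suc n"]) auto
      qed
      with x(1) show "x \<in> ?N" by auto
    qed
    then show ?thesis using D_union[OF C] by (simp add: c_def)
  qed
  moreover have "measure P ?N \<le> 1 - q / (c + q)"
  proof -
    have U_meas: "(\<Union>n. D J n) \<in> sets P"
      using D_meas[OF J] by auto
    have "measure P ?N \<le> measure P (space P - (\<Union>n. D J n))"
    proof (rule P.finite_measure_mono, rule subsetI)
      fix x assume x: "x \<in> ?N"
      have False if "x \<in> D J n" for n
      proof -
        from that have n: "x (Suc n) \<in> J" "\<And>i. i \<in> {1..n} \<Longrightarrow> x i \<notin> C"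
          by (force simp: D_def)+
        with x obtain l where "l \<in> {1..Suc n}" "x l \<in> C" by force
        with n show False using \<open>C \<inter> J = {}\<close> by (cases "l = Suc n") auto
      qed
      with x show "x \<in> space P - (\<Union>n. D J n)" by auto
    qed (use U_meas in auto)
    also have "\<dots> = 1 - q / (c + q)"
      using P.prob_compl[OF U_meas] D_union[OF J] by (simp add: q_def)
    finally show ?thesis .
  qed
  moreover have "1 - q / (c + q) = c / (c + q)"
    using cq by (simp add: field_simps)
  ultimately show ?thesis
    by (simp add: c_def q_def)
qed

text \<open>
  The exit time is eliminated here: it exceeds \<open>j\<close> if and only if the first \<open>j\<close> sample points lie
  in \<open>[0, R\<^sub>k)\<close>. The condition is thereby visibly measurable in breaks and samples jointly.
\<close>

definition all_pieces_hit :: "nat \<Rightarrow> (nat \<Rightarrow> real) \<Rightarrow> (nat \<Rightarrow> real) \<Rightarrow> bool" where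
  "all_pieces_hit k w x \<longleftrightarrow>
    (\<forall>i\<in>{1..k}. \<exists>j\<ge>1. (\<forall>l\<in>{1..j}. x l \<in> {0..<1 - tail_length k w}) \<and>
       x j \<in> {1 - tail_length (i - 1) w..<1 - tail_length i w})"

text \<open>
  The pieces are disjoint intervals below \<open>R\<^sub>k\<close>, so \<open>prob_hit_before\<close> applies to the union of any
  of them. A break equal to 1 would leave nothing beyond \<open>R\<^sub>k\<close>, and the samples would almost surely never exit.
\<close>

lemma prob_all_pieces_hit:
  fixes k :: nat
  defines "P \<equiv> PiM {1..} (\<lambda>_ :: nat. unif)"
  assumes w: "\<And>i. i \<in> {1..k} \<Longrightarrow> w i \<in> {0..<1}"
  shows "measure P {x \<in> space P. all_pieces_hit k w x}
    = (\<Sum>A\<in>Pow {1..k}. (- 1) ^ card A * tail_share A k w)"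
proof -
  interpret P: prob_space P
    unfolding P_def by (intro prob_space_PiM prob_space_unif)
  define L where "L i = tail_length i w" for i
  define I where "I i = {1 - L (i - 1)..<1 - L i}" for i
  define C where "C = - {0..<1 - L k}"
  define N where "N i = {x \<in> space P. \<forall>j\<ge>1. x j \<in> I i \<longrightarrow> (\<exists>l\<in>{1..j}. x l \<in> C)}" for i
  have L_Suc: "L (Suc i) \<le> L i" if "Suc i \<le> k" for i
  proof -
    have "0 < L i" unfolding L_def using that w by (intro tail_length_pos) auto
    then show ?thesis
      using w[of "Suc i"] that by (simp add: L_def tail_length_Suc mult_left_le_one_le)
  qed
  have L_mono: "L j \<le> L i" if "i \<le> j" "j \<le> k" for i j
    using that by (induction j rule: dec_induct) (auto intro: order_trans[OF L_Suc])
  have L_pos: "0 < L k" unfolding L_def by (rule tail_length_pos[OF w])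
  have L_le: "L i \<le> 1" if "i \<le> k" for i
    using L_mono[of 0 i] that by (simp add: L_def)
  have C_meas: "C \<in> sets borel" and I_meas: "I i \<in> sets borel" for i
    by (auto simp: C_def I_def)
  have N_meas: "N i \<in> P.events" for i
    unfolding N_def P_def using C_meas I_meas by measurable
  have disj: "disjoint_family_on I {1..k}"
  proof (unfold disjoint_family_on_def, intro ballI impI, rule ccontr)
    fix i j assume "i \<in> {1..k}" "j \<in> {1..k}" "i \<noteq> j" "I i \<inter> I j \<noteq> {}"
    then obtain a b x where ab: "a < b" "b \<in> {1..k}" "x \<in> I a" "x \<in> I b"
      by (metis disjoint_iff linorder_neqE_nat)
    then have "L (b - 1) \<le> L a" by (intro L_mono) auto
    with ab show False by (auto simp: I_def)
  qed
  have I_sub: "I i \<subseteq> {0..<1 - L k}" if "i \<in> {1..k}" for i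
  proof -
    have "L (i - 1) \<le> 1" "L k \<le> L i"
      using that by (auto intro!: L_le L_mono)
    then show ?thesis by (auto simp: I_def)
  qed
  have measure_C: "measure unif C = L k"
  proof -
    have "{0..1} \<inter> C = {1 - L k..1}"
      using L_le[of k] by (auto simp: C_def)
    then show ?thesis
      using L_pos C_meas by (simp add: measure_unif)
  qed
  have measure_I: "measure unif (I i) = piece i w" if "i \<in> {1..k}" for i
  proof -
    have i: "L i \<le> L (i - 1)" "Suc (i - 1) = i"
      using that by (auto intro!: L_mono)
    have "{0..1} \<inter> I i = I i"
      using I_sub[OF that] L_pos by auto
    then have "measure unif (I i) = L (i - 1) - L i"
      using I_meas i by (simp add: measure_unif) (simp add: I_def)
    also have "L i = (1 - w i) * L (i - 1)"
      using tail_length_Suc[of "i - 1" w] i by (simp add: L_def)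
    finally show ?thesis by (simp add: piece_def L_def algebra_simps)
  qed
  have "{x \<in> space P. all_pieces_hit k w x} = {x \<in> space P. \<forall>i\<in>{1..k}. x \<notin> N i}"
    by (force simp: all_pieces_hit_def N_def C_def I_def L_def)
  also have "P.prob \<dots> = (\<Sum>A\<in>Pow {1..k}. (- 1) ^ card A * P.prob {x \<in> space P. \<forall>i\<in>A. x \<in> N i})"
    by (rule P.prob_avoid_all) (use N_meas in auto)
  also have "\<dots> = (\<Sum>A\<in>Pow {1..k}. (- 1) ^ card A * tail_share A k w)"
  proof (rule sum.cong[OF refl])
    fix A assume "A \<in> Pow {1..k}"
    then have A: "A \<subseteq> {1..k}" "finite A" by (auto intro: finite_subset)
    have measure_UN: "measure unif (\<Union>i\<in>A. I i) = (\<Sum>i\<in>A. piece i w)"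
    proof -
      interpret U: prob_space unif by (rule prob_space_unif)
      have "measure unif (\<Union>i\<in>A. I i) = (\<Sum>i\<in>A. measure unif (I i))"
        using A I_meas disjoint_family_on_mono[OF A(1) disj]
        by (intro U.finite_measure_finite_Union) auto
      also have "\<dots> = (\<Sum>i\<in>A. piece i w)"
        using A measure_I by (intro sum.cong) auto
      finally show ?thesis .
    qed
    have "{x \<in> space P. \<forall>i\<in>A. x \<in> N i}
        = {x \<in> space P. \<forall>j\<ge>1. x j \<in> (\<Union>i\<in>A. I i) \<longrightarrow> (\<exists>l\<in>{1..j}. x l \<in> C)}"
      by (auto simp: N_def)
    also have "P.prob \<dots> = L k / (L k + (\<Sum>i\<in>A. piece i w))"
      unfolding P_def measure_C[symmetric] measure_UN[symmetric]
    proof (rule prob_hit_before[OF prob_space_unif])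
      show "C \<inter> (\<Union>i\<in>A. I i) = {}"
        using A I_sub unfolding C_def by blast
      show "0 < measure unif C + measure unif (\<Union>i\<in>A. I i)"
        using measure_C L_pos by (simp add: add_pos_nonneg)
    qed (use C_meas I_meas A in auto)
    finally show "(- 1) ^ card A * P.prob {x \<in> space P. \<forall>i\<in>A. x \<in> N i} = (- 1) ^ card A * tail_share A k w"
      using A by (simp add: tail_share_def L_def Int_absorb2)
  qed
  finally show ?thesis .
qed

section \<open>Averaging over the breaks\<close>

lemma all_pieces_hit_iff_first_exit:
  "(\<forall>i\<in>{1..k}. \<exists>j\<ge>1. enat j < first_exit W U k \<omega> \<and> U j \<omega> \<in> stick_I W i \<omega>) \<longleftrightarrow>
    all_pieces_hit k (\<lambda>i\<in>{1..k}. W i \<omega>) (\<lambda>i\<in>{1..}. U i \<omega>)"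
proof -
  have R: "stick_R W i \<omega> = 1 - tail_length i (\<lambda>i\<in>{1..k}. W i \<omega>)" if "i \<le> k" for i
    unfolding stick_R_def tail_length_def using that by (auto intro!: prod.cong)
  have exit: "enat j < first_exit W U k \<omega> \<longleftrightarrow> (\<forall>l\<in>{1..j}. U l \<omega> \<in> {0..<stick_R W k \<omega>})" for j
  proof -
    let ?S = "{n. 1 \<le> n \<and> U n \<omega> \<notin> {0..<stick_R W k \<omega>}}"
    have "enat j < Inf (enat ` ?S) \<longleftrightarrow> (\<forall>n\<in>?S. j < n)"
    proof
      assume less: "enat j < Inf (enat ` ?S)"
      show "\<forall>n\<in>?S. j < n"
      proof
        fix n assume "n \<in> ?S"
        then have "Inf (enat ` ?S) \<le> enat n" by (intro Inf_lower imageI)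
        with less have "enat j < enat n" by (rule less_le_trans)
        then show "j < n" by simp
      qed
    next
      assume all: "\<forall>n\<in>?S. j < n"
      have "enat (Suc j) \<le> Inf (enat ` ?S)"
      proof (rule Inf_greatest)
        fix y assume "y \<in> enat ` ?S"
        then obtain n where "n \<in> ?S" "y = enat n" by blast
        then show "enat (Suc j) \<le> y" using all by (simp add: Suc_le_eq)
      qed
      then show "enat j < Inf (enat ` ?S)"
        by (rule less_le_trans[rotated]) simp
    qed
    also have "\<dots> \<longleftrightarrow> (\<forall>l. 1 \<le> l \<longrightarrow> l \<le> j \<longrightarrow> U l \<omega> \<in> {0..<stick_R W k \<omega>})"
      by (auto simp only: mem_Collect_eq not_le[symmetric])
    finally show ?thesis
      unfolding first_exit_def by (auto simp only: atLeastAtMost_iff)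
  qed
  have "(\<exists>j\<ge>1. enat j < first_exit W U k \<omega> \<and> U j \<omega> \<in> stick_I W i \<omega>) \<longleftrightarrow>
      (\<exists>j\<ge>1. (\<forall>l\<in>{1..j}. (\<lambda>i\<in>{1..}. U i \<omega>) l \<in> {0..<1 - tail_length k (\<lambda>i\<in>{1..k}. W i \<omega>)}) \<and>
        (\<lambda>i\<in>{1..}. U i \<omega>) j \<in> {1 - tail_length (i - 1) (\<lambda>i\<in>{1..k}. W i \<omega>)..<1 - tail_length i (\<lambda>i\<in>{1..k}. W i \<omega>)})"
    if "i \<in> {1..k}" for i
    unfolding exit stick_I_def using that by (intro ex_cong1 conj_cong) (auto simp: R)
  then show ?thesis
    unfolding all_pieces_hit_def by (intro ball_cong) auto
qed

text \<open>
  By Fubini, the samples are integrated out for fixed breaks first. Almost all breaks lie in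
  \<open>[0, 1)\<close>, where the inner probability is known.
\<close>

lemma prob_eq_alternating_moment:
  fixes k :: nat
  defines "Q \<equiv> PiM {1..k} (\<lambda>_. unif)" and "P \<equiv> PiM {1..} (\<lambda>_ :: nat. unif)"
  shows "measure (Q \<Otimes>\<^sub>M P) {p \<in> space (Q \<Otimes>\<^sub>M P). all_pieces_hit k (fst p) (snd p)} = alternating_moment k 1"
    (is "measure _ ?S = _")
    and "{p \<in> space (Q \<Otimes>\<^sub>M P). all_pieces_hit k (fst p) (snd p)} \<in> sets (Q \<Otimes>\<^sub>M P)"
proof -
  interpret Q: prob_space Q unfolding Q_def by (intro prob_space_PiM prob_space_unif)
  interpret P: prob_space P unfolding P_def by (intro prob_space_PiM prob_space_unif)
  interpret QP: pair_prob_space Q P ..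
  have tail: "(\<lambda>p. tail_length i (fst p)) \<in> borel_measurable (Q \<Otimes>\<^sub>M P)" if "i \<le> k" for i
    unfolding Q_def by (rule measurable_compose[OF measurable_fst measurable_tail_length[OF that]])
  have coord: "(\<lambda>p. snd p l) \<in> borel_measurable (Q \<Otimes>\<^sub>M P)" for l
  proof -
    have "(\<lambda>x. x l) \<in> borel_measurable P"
    proof (cases "1 \<le> l")
      case True
      then have "(\<lambda>x. x l) \<in> measurable P unif"
        unfolding P_def by (intro measurable_component_singleton) auto
      then show ?thesis by (simp cong: measurable_cong_sets)
    next
      case False
      (* The samples are indexed from 1 on, so the coordinate 0 is constant on the space. *)
      then have "x l = undefined" if "x \<in> space P" for x
        using that by (auto simp: P_def space_PiM PiE_def extensional_def)
      then show ?thesis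
        by (subst measurable_cong[where g = "\<lambda>_. undefined"]) auto
    qed
    then show ?thesis
      by (rule measurable_compose[OF measurable_snd])
  qed
  have between: "{p \<in> space (Q \<Otimes>\<^sub>M P). snd p l \<in> {f p..<g p}} \<in> sets (Q \<Otimes>\<^sub>M P)"
    if "f \<in> borel_measurable (Q \<Otimes>\<^sub>M P)" "g \<in> borel_measurable (Q \<Otimes>\<^sub>M P)" for l f g
  proof -
    have "{p \<in> space (Q \<Otimes>\<^sub>M P). snd p l \<in> {f p..<g p}}
        = {p \<in> space (Q \<Otimes>\<^sub>M P). f p \<le> snd p l} \<inter> {p \<in> space (Q \<Otimes>\<^sub>M P). snd p l < g p}"
      by auto
    also have "\<dots> \<in> sets (Q \<Otimes>\<^sub>M P)"
      using that coord[of l]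
      by (intro sets.Int borel_measurable_le borel_measurable_less)
    finally show ?thesis .
  qed
  show S: "?S \<in> sets (Q \<Otimes>\<^sub>M P)"
    unfolding all_pieces_hit_def
    by (intro sets.sets_Collect_finite_All sets.sets_Collect_countable_Ex sets.sets_Collect_conj
        sets.sets_Collect_const between borel_measurable_diff tail borel_measurable_const) auto
  have int: "integrable Q (\<lambda>w. tail_share A k w)" for A
  proof (rule Q.integrable_const_bound[where B = 1])
    show "AE w in Q. norm (tail_share A k w) \<le> 1"
      unfolding Q_def using AE_PiM_unif[of k]
      by eventually_elim (use tail_share_bounds[of k _ A] in auto)
    show "tail_share A k \<in> borel_measurable Q"
      unfolding Q_def by measurable
  qed
  have "measure (Q \<Otimes>\<^sub>M P) ?S = (\<integral>p. indicator ?S p \<partial>(Q \<Otimes>\<^sub>M P))"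
    using S by simp
  also have "\<dots> = (\<integral>w. (\<integral>x. indicator ?S (w, x) \<partial>P) \<partial>Q)"
    using S by (intro QP.integral_fst'[symmetric] integrable_real_indicator)
      (auto simp: QP.emeasure_eq_measure)
  also have "\<dots> = (\<integral>w. (\<Sum>A\<in>Pow {1..k}. (- 1) ^ card A * tail_share A k w) \<partial>Q)"
  proof (rule integral_cong_AE)
    show "(\<lambda>w. \<integral>x. indicator ?S (w, x) \<partial>P :: real) \<in> borel_measurable Q"
    proof (rule P.borel_measurable_lebesgue_integral)
      show "(\<lambda>(w, x). indicator ?S (w, x) :: real) \<in> borel_measurable (Q \<Otimes>\<^sub>M P)"
        using S by simp
    qed
    show "(\<lambda>w. \<Sum>A\<in>Pow {1..k}. (- 1) ^ card A * tail_share A k w) \<in> borel_measurable Q"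
      unfolding Q_def by measurable
    show "AE w in Q. (\<integral>x. indicator ?S (w, x) \<partial>P) = (\<Sum>A\<in>Pow {1..k}. (- 1) ^ card A * tail_share A k w)"
      using AE_PiM_unif[of k, folded Q_def] AE_space
    proof eventually_elim
      case (elim w)
      have "(\<integral>x. indicator ?S (w, x) \<partial>P) = (\<integral>x. indicator {x \<in> space P. all_pieces_hit k w x} x \<partial>P)"
        using elim(2) by (intro Bochner_Integration.integral_cong)
          (auto simp: indicator_def space_pair_measure)
      also have "\<dots> = measure P {x \<in> space P. all_pieces_hit k w x}"
        by simp (rule arg_cong[where f = "measure P"], auto)
      finally show ?case
        using prob_all_pieces_hit[of k w] elim(1) by (simp add: P_def)
    qed
  qed
  also have "\<dots> = (\<Sum>A\<in>Pow {1..k}. (- 1) ^ card A * (\<integral>w. tail_share A k w \<partial>Q))"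
    using int by (subst Bochner_Integration.integral_sum) auto
  also have "\<dots> = alternating_moment k 1"
    unfolding alternating_moment_def
  proof (intro sum.cong refl arg_cong2[where f = "(*)"])
    fix A
    show "(\<integral>w. tail_share A k w \<partial>Q) = enn2real (share_moment A k 1)"
      unfolding share_moment_def Q_def[symmetric] power_one_right
    proof (rule integral_eq_nn_integral)
      show "AE w in Q. 0 \<le> tail_share A k w"
        unfolding Q_def using AE_PiM_unif[of k]
        by eventually_elim (use tail_share_bounds[of k _ A] in auto)
      show "tail_share A k \<in> borel_measurable Q"
        unfolding Q_def by measurable
    qed
  qed
  finally show "measure (Q \<Otimes>\<^sub>M P) ?S = alternating_moment k 1" .
qed

text \<open>
  The joint law of the first \<open>k\<close> breaks and of all samples is a product of uniform laws, so the
  probability on \<open>M\<close> is the one on the product space.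
\<close>

lemma renewal_u_eq_alternating_moment:
  assumes "uniform_stick_breaking M W U" "1 \<le> k"
  shows "renewal_u M W U k = alternating_moment k 1"
proof -
  interpret M: prob_space M
    using assms by (simp add: uniform_stick_breaking_def)
  have iid: "iid_uniform_01 M W" "iid_uniform_01 M U"
    and indep: "M.indep_var (PiM {1..} (\<lambda>_. borel)) (\<lambda>\<omega>. \<lambda>i\<in>{1..}. W i \<omega>)
       (PiM {1..} (\<lambda>_. borel)) (\<lambda>\<omega>. \<lambda>i\<in>{1..}. U i \<omega>)"
    using assms by (simp_all add: uniform_stick_breaking_def)
  define Q where "Q = PiM {1..k} (\<lambda>_. unif)"
  define P where "P = PiM {1..} (\<lambda>_ :: nat. unif)"
  define V where "V \<omega> = (\<lambda>i\<in>{1..k}. W i \<omega>)" for \<omega>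
  define X where "X \<omega> = (\<lambda>i\<in>{1..}. U i \<omega>)" for \<omega>
  have distr_iid: "distr M (PiM I (\<lambda>_. borel)) (\<lambda>\<omega>. \<lambda>i\<in>I. Y i \<omega>) = PiM I (\<lambda>_. unif)"
    if Y: "iid_uniform_01 M Y" and I: "I \<subseteq> {1..}" "I \<noteq> {}" for Y :: "nat \<Rightarrow> 'a \<Rightarrow> real" and I
  proof -
    have "M.indep_vars (\<lambda>_. borel) Y I"
      using Y I(1) M.indep_vars_subset unfolding iid_uniform_01_def by blast
    moreover from this have "M.random_variable borel (Y i)" if "i \<in> I" for i
      using that by (simp add: M.indep_vars_def)
    ultimately have "distr M (PiM I (\<lambda>_. borel)) (\<lambda>\<omega>. \<lambda>i\<in>I. Y i \<omega>) = PiM I (\<lambda>i. distr M borel (Y i))"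
      using M.indep_vars_iff_distr_eq_PiM'[OF I(2), where M' = "\<lambda>_. borel" and X = Y] by simp
    also have "\<dots> = PiM I (\<lambda>_. unif)"
      using Y I(1) unfolding iid_uniform_01_def by (intro PiM_cong) auto
    finally show ?thesis .
  qed
  have V: "distr M (PiM {1..k} (\<lambda>_. borel)) V = Q" and X: "distr M (PiM {1..} (\<lambda>_. borel)) X = P"
    unfolding V_def X_def Q_def P_def using iid assms(2) by (intro distr_iid; force)+
  have "M.indep_var (PiM {1..k} (\<lambda>_. borel)) ((\<lambda>w. restrict w {1..k}) \<circ> (\<lambda>\<omega>. \<lambda>i\<in>{1..}. W i \<omega>))
       (PiM {1..} (\<lambda>_. borel)) (id \<circ> X)"
    unfolding X_def by (rule M.indep_var_compose[OF indep]) (auto intro: measurable_restrict_subset)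
  also have "(\<lambda>w. restrict w {1..k}) \<circ> (\<lambda>\<omega>. \<lambda>i\<in>{1..}. W i \<omega>) = V"
    by (auto simp: V_def fun_eq_iff restrict_def)
  finally have VX: "M.indep_var (PiM {1..k} (\<lambda>_. borel)) V (PiM {1..} (\<lambda>_. borel)) X"
    by simp
  then have joint: "distr M (PiM {1..k} (\<lambda>_. borel) \<Otimes>\<^sub>M PiM {1..} (\<lambda>_. borel)) (\<lambda>\<omega>. (V \<omega>, X \<omega>)) = Q \<Otimes>\<^sub>M P"
    and meas: "V \<in> measurable M (PiM {1..k} (\<lambda>_. borel))" "X \<in> measurable M (PiM {1..} (\<lambda>_. borel))"
    unfolding M.indep_var_distribution_eq V X by auto
  let ?B = "PiM {1..k} (\<lambda>_. borel) \<Otimes>\<^sub>M PiM {1..} (\<lambda>_. borel) :: ((nat \<Rightarrow> real) \<times> (nat \<Rightarrow> real)) measure"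
  let ?S = "{p \<in> space (Q \<Otimes>\<^sub>M P). all_pieces_hit k (fst p) (snd p)}"
  have pair: "(\<lambda>\<omega>. (V \<omega>, X \<omega>)) \<in> measurable M ?B"
    using meas by (rule measurable_Pair)
  have same: "sets (Q \<Otimes>\<^sub>M P) = sets ?B" "space (Q \<Otimes>\<^sub>M P) = space ?B"
    using arg_cong[OF joint, of sets] arg_cong[OF joint, of space] by simp_all
  have "renewal_u M W U k = measure M {\<omega> \<in> space M. all_pieces_hit k (V \<omega>) (X \<omega>)}"
    using assms(2) by (simp only: renewal_u_def all_pieces_hit_iff_first_exit V_def X_def) simp
  also have "{\<omega> \<in> space M. all_pieces_hit k (V \<omega>) (X \<omega>)} = (\<lambda>\<omega>. (V \<omega>, X \<omega>)) -` ?S \<inter> space M"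
    using measurable_space[OF pair] unfolding same(2) by auto
  also have "measure M \<dots> = measure (Q \<Otimes>\<^sub>M P) ?S"
    unfolding joint[symmetric]
    by (rule measure_distr[symmetric, OF pair])
       (use prob_eq_alternating_moment(2)[of k] same in \<open>simp add: Q_def P_def\<close>)
  also have "\<dots> = alternating_moment k 1"
    unfolding Q_def P_def by (rule prob_eq_alternating_moment(1))
  finally show ?thesis .
qed

section \<open>The series, the recurrence and the generating function\<close>

lemma zeta_sums:
  assumes "2 \<le> k"
  shows "(\<lambda>n. 1 / real (Suc n) ^ k) sums zeta (real k)"
proof -
  have "summable (\<lambda>n. inverse (real (Suc n) ^ k))"
    using inverse_power_summable[OF assms, where 'a = real] by (subst summable_Suc_iff)
  then have "(\<lambda>n. 1 / real (Suc n) ^ k) sums (\<Sum>n. 1 / real (Suc n) ^ k)"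
    by (simp only: inverse_eq_divide summable_sums)
  moreover have "real (Suc n) powr (- real k) = 1 / real (Suc n) ^ k" for n
    by (simp only: powr_minus powr_realpow of_nat_0_less_iff zero_less_Suc inverse_eq_divide)
  ultimately show ?thesis
    by (simp only: zeta_def)
qed

definition series_term :: "nat \<Rightarrow> nat \<Rightarrow> real" where
  "series_term k n = 2 / (real (Suc n) ^ k * (real (Suc n) + 1) * (real (Suc n) + 2))"

lemma series_form_altdef: "series_form a \<longleftrightarrow> (\<forall>k. series_term k sums a k)"
proof -
  have "series_term k = (\<lambda>n. let j = real (Suc n) in 2 / (j ^ k * (j + 1) * (j + 2)))" for k
    by (simp add: fun_eq_iff series_term_def Let_def)
  then show ?thesis by (simp only: series_form_def)
qed

lemma series_term_0_sums: "series_term 0 sums 1"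
proof -
  have "(\<lambda>r. 2 * (real 1 * (fact (1 + r) / fact (1 + r + 1 + 1)))) sums (2 * (fact 1 / fact (1 + 1)))"
    by (intro sums_mult fact_ratio_sums) simp
  moreover have "2 * (real 1 * (fact (1 + r) / fact (1 + r + 1 + 1))) = series_term 0 r" for r
    by (simp add: series_term_def divide_simps)
  ultimately show ?thesis by simp
qed

lemma series_term_1_sums: "series_term 1 sums (1 / 2)"
proof -
  have "(\<lambda>r. real 2 * (fact (0 + r) / fact (0 + r + 2 + 1))) sums (fact 0 / fact (0 + 2))"
    by (intro fact_ratio_sums) simp
  moreover have "real 2 * (fact (0 + r) / fact (0 + r + 2 + 1)) = series_term 1 r" for r
    by (simp add: series_term_def divide_simps numeral_3_eq_3)
  ultimately show ?thesis by simp
qed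

lemma series_term_nonneg: "0 \<le> series_term k n"
  by (simp add: series_term_def)

lemma series_term_le: "series_term k n \<le> series_term 0 n"
proof -
  have "(1 :: real) \<le> real (Suc n) ^ k"
    by (rule one_le_power) simp
  then have "1 * ((real (Suc n) + 1) * (real (Suc n) + 2))
      \<le> real (Suc n) ^ k * ((real (Suc n) + 1) * (real (Suc n) + 2))"
    by (intro mult_right_mono) auto
  then show ?thesis
    unfolding series_term_def by (intro divide_left_mono) (auto simp: mult.assoc intro!: mult_pos_pos)
qed

lemma summable_series_term: "summable (series_term k)"
  by (rule summable_comparison_test'[OF sums_summable[OF series_term_0_sums], of 0])
    (simp add: series_term_nonneg series_term_le)

definition series_value :: "nat \<Rightarrow> real" where
  "series_value k = suminf (series_term k)"

lemma series_value_sums: "series_term k sums series_value k"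
  unfolding series_value_def by (rule summable_sums[OF summable_series_term])

lemma series_form_iff: "series_form a \<longleftrightarrow> a = series_value"
proof
  assume "series_form a"
  then show "a = series_value"
    using sums_unique2[OF _ series_value_sums] by (auto simp: series_form_altdef)
qed (simp add: series_form_altdef series_value_sums)

lemma zeta_recurrence_series_value: "zeta_recurrence series_value"
  unfolding zeta_recurrence_def
proof (intro conjI allI impI)
  show "series_value 0 = 1" "series_value 1 = 1 / 2"
    using sums_unique2[OF series_value_sums] series_term_0_sums series_term_1_sums by auto
  fix k :: nat assume k: "2 \<le> k"
  then obtain l where l: "k = Suc (Suc l)"
    by (metis add_2_eq_Suc le_Suc_ex)
  have "(\<lambda>n. 2 * series_term k n + 3 * series_term (k - 1) n + series_term (k - 2) n)
      sums (2 * series_value k + 3 * series_value (k - 1) + series_value (k - 2))"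
    by (intro sums_add sums_mult series_value_sums)
  moreover have "2 * series_term k n + 3 * series_term (k - 1) n + series_term (k - 2) n
      = 2 * (1 / real (Suc n) ^ k)" for n
  proof -
    define j where "j = real (Suc n)"
    have "0 < j" by (simp add: j_def)
    then have nz: "j \<noteq> 0" "j + 1 \<noteq> 0" "j + 2 \<noteq> 0" "j ^ l \<noteq> 0" by auto
    have "2 * (2 / (j * j * j ^ l * (j + 1) * (j + 2))) + 3 * (2 / (j * j ^ l * (j + 1) * (j + 2)))
        + 2 / (j ^ l * (j + 1) * (j + 2)) = 2 * ((j + 1) * (j + 2) / (j * j * j ^ l * (j + 1) * (j + 2)))"
      using nz by (simp add: add_frac_eq frac_eq_eq) (simp add: algebra_simps)
    also have "\<dots> = 2 * (1 / (j * j * j ^ l))"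
      using nz by simp
    finally show ?thesis
      by (simp add: series_term_def l j_def[symmetric] mult.assoc del: of_nat_Suc)
  qed
  moreover have "(\<lambda>n. 2 * (1 / real (Suc n) ^ k)) sums (2 * zeta (real k))"
    by (intro sums_mult zeta_sums k)
  ultimately show "2 * series_value k + 3 * series_value (k - 1) + series_value (k - 2) = 2 * zeta (real k)"
    using sums_unique2 by simp
qed

lemma zeta_recurrence_unique:
  assumes a: "zeta_recurrence a" and b: "zeta_recurrence b"
  shows "a = b"
proof
  fix k show "a k = b k"
  proof (induction k rule: less_induct)
    case (less k)
    consider "k = 0" | "k = 1" | "2 \<le> k" by linarith
    then show ?case
    proof cases
      case 3
      then have "2 * a k + 3 * a (k - 1) + a (k - 2) = 2 * b k + 3 * b (k - 1) + b (k - 2)"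
        using a b by (simp add: zeta_recurrence_def)
      then show ?thesis
        using less[of "k - 1"] less[of "k - 2"] 3 by simp
    qed (use a b in \<open>simp_all add: zeta_recurrence_def\<close>)
  qed
qed

lemma zeta_recurrence_iff: "zeta_recurrence a \<longleftrightarrow> a = series_value"
  using zeta_recurrence_unique zeta_recurrence_series_value by blast

text \<open>
  The coefficients \<open>(-1)^r * (2 - 1 / 2^r)\<close> and the term outside the sum both satisfy the
  homogeneous recurrence, whose characteristic roots are \<open>-1\<close> and \<open>-1 / 2\<close>. In the convolution with
  the zeta values only the newest summand \<open>zeta k\<close> survives.
\<close>

lemma zeta_closed_form_imp_recurrence:
  assumes "zeta_closed_form a"
  shows "zeta_recurrence a"
proof -
  define b :: "nat \<Rightarrow> real" where "b r = (- 1) ^ r * (2 - 1 / 2 ^ r)" for r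
  define e :: "nat \<Rightarrow> real" where "e k = (- 1) powi (int k - 1) * (2 - 3 / 2 ^ k)" for k
  define S where "S k = (\<Sum>j=2..k. b (k - j) * zeta (real j))" for k
  have a: "a k = e k + S k" for k
    using assms by (simp add: zeta_closed_form_def e_def S_def b_def)
  have e_Suc: "e (Suc k) = (- 1) ^ k * (2 - 3 / 2 ^ Suc k)" for k
    by (simp add: e_def power_int_def)
  have e: "e 0 = 1" "e 1 = 1 / 2"
    using e_Suc[of 0] by (simp_all add: e_def)
  have e_rec: "2 * e (Suc (Suc k)) + 3 * e (Suc k) + e k = 0" for k
  proof (cases k)
    case 0
    then show ?thesis using e e_Suc[of 1] by simp
  next
    case (Suc l)
    then show ?thesis by (simp add: e_Suc algebra_simps add_divide_distrib)
  qed
  have b: "b 0 = 1" "b 1 = - (3 / 2)"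
    by (simp_all add: b_def)
  have b_rec: "2 * b (Suc (Suc r)) + 3 * b (Suc r) + b r = 0" for r
    by (simp add: b_def algebra_simps)
  have S: "S 0 = 0" "S 1 = 0"
    by (simp_all add: S_def)
  have S_rec: "2 * S (Suc (Suc k)) + 3 * S (Suc k) + S k = 2 * zeta (real (Suc (Suc k)))" for k
  proof -
    (* The part of the convolution at k + c over the indices that also occur at k. *)
    define Z where "Z c = (\<Sum>j=2..k. b (k + c - j) * zeta (real j))" for c
    have "S (Suc (Suc k)) = Z 2 + (if 1 \<le> k then b 1 * zeta (real (Suc k)) else 0) + zeta (real (Suc (Suc k)))"
      by (cases k) (simp_all add: S_def Z_def b)
    moreover have "S (Suc k) = Z 1 + (if 1 \<le> k then zeta (real (Suc k)) else 0)"
      by (cases k) (simp_all add: S_def Z_def b)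
    moreover have "S k = Z 0"
      by (simp add: S_def Z_def)
    moreover have "2 * Z 2 + 3 * Z 1 + Z 0 = 0"
    proof -
      have "2 * Z 2 + 3 * Z 1 + Z 0
          = (\<Sum>j=2..k. (2 * b (k + 2 - j) + 3 * b (k + 1 - j) + b (k + 0 - j)) * zeta (real j))"
        by (simp add: Z_def sum_distrib_left sum.distrib algebra_simps)
      also have "\<dots> = (\<Sum>j=2..k. 0)"
      proof (rule sum.cong[OF refl])
        fix j assume "j \<in> {2..k}"
        then have "k + 2 - j = Suc (Suc (k - j))" "k + 1 - j = Suc (k - j)" by auto
        then show "(2 * b (k + 2 - j) + 3 * b (k + 1 - j) + b (k + 0 - j)) * zeta (real j) = 0"
          using b_rec[of "k - j"] by simp
      qed
      finally show ?thesis by simp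
    qed
    ultimately show ?thesis
      using b(2) by (cases "1 \<le> k") (simp_all add: algebra_simps)
  qed
  show ?thesis
    unfolding zeta_recurrence_def
  proof (intro conjI allI impI)
    show "a 0 = 1" "a 1 = 1 / 2"
      by (simp_all only: a e S add_0_right)
    fix k :: nat assume "2 \<le> k"
    then obtain l where l: "k = Suc (Suc l)"
      by (metis add_2_eq_Suc le_Suc_ex)
    show "2 * a k + 3 * a (k - 1) + a (k - 2) = 2 * zeta (real k)"
      using e_rec[of l] S_rec[of l] by (simp add: l a algebra_simps del: of_nat_Suc)
  qed
qed

lemma zeta_closed_form_iff: "zeta_closed_form a \<longleftrightarrow> a = series_value"
proof
  assume "zeta_closed_form a"
  then show "a = series_value"
    using zeta_closed_form_imp_recurrence zeta_recurrence_iff by blast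
next
  define c where "c k = (- 1) powi (int k - 1) * (2 - 3 / 2 ^ k) +
    (\<Sum>j=2..k. (- 1) ^ (k - j) * (2 - 1 / 2 ^ (k - j)) * zeta (real j))" for k
  have "zeta_closed_form c"
    by (simp add: zeta_closed_form_def c_def)
  moreover from this have "c = series_value"
    using zeta_closed_form_imp_recurrence zeta_recurrence_iff by blast
  moreover assume "a = series_value"
  ultimately show "zeta_closed_form a" by simp
qed

text \<open>
  If the coefficients before the \<open>k\<close>-th vanish, dividing by \<open>z ^ k\<close> leaves a power series that is
  zero off the origin and tends to \<open>d k\<close> at the origin.
\<close>

lemma power_series_zero_imp_coeff_zero:
  fixes d :: "nat \<Rightarrow> complex"
  assumes "\<And>z. norm z < 1 \<Longrightarrow> (\<lambda>k. d k * z ^ k) sums 0"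
  shows "d k = 0"
proof (induction k rule: less_induct)
  case (less k)
  have "(\<lambda>n. d (n + k) * z ^ n) sums 0" if "z \<noteq> 0" "norm z < 1" for z
  proof -
    have "(\<lambda>n. d (n + k) * z ^ (n + k)) sums 0"
      using assms[OF that(2)] less by (subst sums_zero_iff_shift) auto
    then have "(\<lambda>n. d (n + k) * z ^ (n + k) / z ^ k) sums (0 / z ^ k)"
      by (rule sums_divide)
    then show ?thesis
      using that(1) by (simp add: power_add)
  qed
  then have "((\<lambda>_. 0) \<longlongrightarrow> d (0 + k)) (at (0 :: complex))"
    using powser_limit_0_strong[of 1 "\<lambda>n. d (n + k)" "\<lambda>_. 0"] by simp
  then show ?case
    by (simp add: tendsto_const_iff)
qed

lemma generating_function_unique:
  assumes "generating_function_form a" "generating_function_form b"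
  shows "a = b"
proof
  fix k
  have "complex_of_real (a k) - complex_of_real (b k) = 0"
  proof (rule power_series_zero_imp_coeff_zero)
    fix z :: complex assume z: "norm z < 1"
    then show "(\<lambda>k. (complex_of_real (a k) - complex_of_real (b k)) * z ^ k) sums 0"
      using sums_diff[OF assms(1)[unfolded generating_function_form_def, rule_format, OF z]
          assms(2)[unfolded generating_function_form_def, rule_format, OF z]]
      by (simp add: left_diff_distrib)
  qed
  then show "a k = b k" by simp
qed

text \<open>
  Summing over \<open>k\<close> first gives \<open>\<Sum>j\<ge>1. 2 j / ((j + 1) * (j + 2) * (j - z))\<close>. Up to the factor
  \<open>2 / ((1 + z) * (2 + z))\<close>, the partial fractions of its terms are \<open>z / (j - z)\<close>,
  \<open>(2 + z) / (j + 1)\<close> and \<open>- (2 + 2 z) / (j + 2)\<close>. Subtracting and adding \<open>z / j\<close> splits this into the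
  digamma series at \<open>1 - z\<close> and telescoping series.
\<close>

lemma generating_function_series_value: "generating_function_form series_value"
  unfolding generating_function_form_def
proof (intro allI impI)
  fix z :: complex assume z: "norm z < 1"
  define j :: "nat \<Rightarrow> complex" where "j n = of_nat (Suc n)" for n
  have j_norm: "1 \<le> norm (j n)" for n
    by (simp add: j_def del: of_nat_Suc)
  have j_nz: "j n \<noteq> 0" "j n + 1 \<noteq> 0" "j n + 2 \<noteq> 0" for n
  proof -
    have "j n = of_nat (Suc n)" "j n + 1 = of_nat (Suc (Suc n))" "j n + 2 = of_nat (Suc (Suc (Suc n)))"
      by (simp_all add: j_def)
    then show "j n \<noteq> 0" "j n + 1 \<noteq> 0" "j n + 2 \<noteq> 0"
      by (simp_all only: of_nat_eq_0_iff)
  qed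
  have j_z: "j n - z \<noteq> 0" for n
    using j_norm[of n] z by auto
  have z_nz: "1 + z \<noteq> 0" "2 + z \<noteq> 0"
  proof -
    have "z \<noteq> -1" "z \<noteq> -2" using z by auto
    then show "1 + z \<noteq> 0" "2 + z \<noteq> 0"
      by (metis add_eq_0_iff)+
  qed
  define U where "U = 2 / ((1 + z) * (2 + z)) * (1 + (2 - euler_mascheroni - Digamma (1 - z)) * z)"
  define f where "f n k = complex_of_real (series_term k n) * z ^ k" for n k
  have factor: "complex_of_real (series_term k n) = complex_of_real (series_term 0 n) * (1 / j n) ^ k" for k n
    by (simp add: series_term_def j_def power_divide del: of_nat_Suc)
  have rows: "f n sums (complex_of_real (series_term 0 n) * (1 / (1 - z / j n)))" for n
  proof -
    have "norm (z / j n) < 1"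
      using j_norm[of n] z by (simp add: norm_divide divide_simps)
    then have "(\<lambda>k. complex_of_real (series_term 0 n) * (z / j n) ^ k)
        sums (complex_of_real (series_term 0 n) * (1 / (1 - z / j n)))"
      by (intro sums_mult geometric_sums)
    moreover have "complex_of_real (series_term 0 n) * (z / j n) ^ k = f n k" for k
      unfolding f_def by (subst (2) factor) (simp add: power_divide)
    ultimately show ?thesis by simp
  qed
  have f_norm: "norm (f n k) \<le> series_term 0 n * norm z ^ k" for n k
    using series_term_le[of k n] series_term_nonneg[of k n]
    by (simp add: f_def norm_mult norm_power mult_right_mono)
  have f_summable: "summable (\<lambda>k. norm (f n k))" for n
    by (rule summable_comparison_test'[of "\<lambda>k. series_term 0 n * norm z ^ k" 0])
      (use z f_norm in \<open>auto intro!: summable_mult summable_geometric\<close>)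
  have norms_summable: "summable (\<lambda>n. \<Sum>k. norm (f n k))"
  proof (rule summable_comparison_test'[of "\<lambda>n. series_term 0 n * (1 / (1 - norm z))" 0])
    show "summable (\<lambda>n. series_term 0 n * (1 / (1 - norm z)))"
      by (intro summable_mult2 summable_series_term)
    fix n :: nat
    have geo: "(\<lambda>k. series_term 0 n * norm z ^ k) sums (series_term 0 n * (1 / (1 - norm z)))"
      using z by (intro sums_mult geometric_sums) auto
    have "(\<Sum>k. norm (f n k)) \<le> series_term 0 n * (1 / (1 - norm z))"
      by (rule sums_le[OF f_norm summable_sums[OF f_summable] geo])
    moreover have "0 \<le> (\<Sum>k. norm (f n k))"
      by (intro suminf_nonneg f_summable) auto
    ultimately show "norm (\<Sum>k. norm (f n k)) \<le> series_term 0 n * (1 / (1 - norm z))"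
      by simp
  qed
  have total: "(\<lambda>n. complex_of_real (series_term 0 n) * (1 / (1 - z / j n))) sums U"
  proof -
    have digamma: "(\<lambda>n. 1 / j n - 1 / (j n - z)) sums (Digamma (1 - z) + euler_mascheroni)"
    proof -
      have "1 - z \<noteq> 0" using z by auto
      then have "(\<lambda>n. inverse (of_nat (Suc n)) - inverse (1 - z + of_nat n))
          sums (\<Sum>n. inverse (of_nat (Suc n)) - inverse (1 - z + of_nat n))"
        by (intro summable_sums summable_Digamma)
      then show ?thesis
        by (simp add: Digamma_def j_def inverse_eq_divide algebra_simps)
    qed
    have half: "(\<lambda>n. 1 / (j n + 1) - 1 / (j n + 2)) sums (1 / 2)"
    proof -
      have "(\<lambda>n. of_real (series_term 0 n / 2)) sums (of_real (1 / 2) :: complex)"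
        by (intro sums_of_real sums_divide series_term_0_sums)
      moreover have "of_real (series_term 0 n / 2) = 1 / (j n + 1) - 1 / (j n + 2)" for n
        using j_nz[of n] by (simp add: series_term_def diff_frac_eq) (simp add: j_def)
      ultimately show ?thesis
        by (simp only: of_real_divide of_real_1 of_real_numeral)
    qed
    have one: "(\<lambda>n. 1 / j n - 1 / (j n + 1)) sums 1"
    proof -
      have "(\<lambda>r. real 1 * (fact (0 + r) / fact (0 + r + 1 + 1))) sums (fact 0 / fact (0 + 1))"
        by (intro fact_ratio_sums) simp
      then have "(\<lambda>n. of_real (real 1 * (fact (0 + n) / fact (0 + n + 1 + 1)))) sums (of_real (fact 0 / fact (0 + 1)) :: complex)"
        by (rule sums_of_real)
      moreover have "of_real (real 1 * (fact (0 + n) / fact (0 + n + 1 + 1))) = 1 / j n - 1 / (j n + 1)" for n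
      proof -
        have "(fact (0 + n + 1 + 1) :: complex) = (j n + 1) * j n * fact n"
          by (simp add: j_def algebra_simps)
        then show ?thesis
          using j_nz[of n] by (simp add: diff_frac_eq del: fact_Suc)
      qed
      ultimately show ?thesis by simp
    qed
    have "(\<lambda>n. 2 / ((1 + z) * (2 + z)) * (- z * (1 / j n - 1 / (j n - z))
          + (z * (1 / j n - 1 / (j n + 1)) + (2 * z + 2) * (1 / (j n + 1) - 1 / (j n + 2)))))
        sums (2 / ((1 + z) * (2 + z)) * (- z * (Digamma (1 - z) + euler_mascheroni)
          + (z * 1 + (2 * z + 2) * (1 / 2))))"
      by (intro sums_mult sums_add digamma one half)
    moreover have "2 / ((1 + z) * (2 + z)) * (- z * (1 / j n - 1 / (j n - z))
          + (z * (1 / j n - 1 / (j n + 1)) + (2 * z + 2) * (1 / (j n + 1) - 1 / (j n + 2))))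
        = complex_of_real (series_term 0 n) * (1 / (1 - z / j n))" for n
    proof -
      have "- z * (1 / j n - 1 / (j n - z))
          + (z * (1 / j n - 1 / (j n + 1)) + (2 * z + 2) * (1 / (j n + 1) - 1 / (j n + 2)))
          = z / (j n - z) + (2 + z) / (j n + 1) - (2 + 2 * z) / (j n + 2)"
        by (simp add: algebra_simps add_divide_distrib diff_divide_distrib)
      also have "\<dots> = (1 + z) * (2 + z) * (j n / ((j n + 1) * (j n + 2) * (j n - z)))"
        using j_nz[of n] j_z[of n]
        by (simp add: add_frac_eq diff_frac_eq frac_eq_eq) (simp add: algebra_simps)
      also have "2 / ((1 + z) * (2 + z)) * \<dots> = 2 / ((j n + 1) * (j n + 2)) * (j n / (j n - z))"
        using z_nz by simp
      also have "j n / (j n - z) = 1 / (1 - z / j n)"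
        using j_nz[of n] j_z[of n] by (simp add: field_simps)
      also have "2 / ((j n + 1) * (j n + 2)) = complex_of_real (series_term 0 n)"
        by (simp add: series_term_def j_def)
      finally show ?thesis .
    qed
    moreover have "2 / ((1 + z) * (2 + z)) * (- z * (Digamma (1 - z) + euler_mascheroni)
          + (z * 1 + (2 * z + 2) * (1 / 2))) = U"
    proof -
      have "- z * (Digamma (1 - z) + euler_mascheroni) + (z * 1 + (2 * z + 2) * (1 / 2))
          = 1 + (2 - euler_mascheroni - Digamma (1 - z)) * z"
        by (simp add: algebra_simps)
      then show ?thesis by (simp only: U_def)
    qed
    ultimately show ?thesis by simp
  qed
  have columns: "(\<lambda>n. f n k) sums (complex_of_real (series_value k) * z ^ k)" for k
    unfolding f_def by (intro sums_mult2 sums_of_real series_value_sums)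
  have "(\<lambda>k. complex_of_real (series_value k) * z ^ k) sums U"
    by (rule sums_swap_absolutely[where f = f, OF summable_sums[OF f_summable] norms_summable rows total columns])
  then show "(\<lambda>k. complex_of_real (series_value k) * z ^ k) sums
      (2 / ((1 + z) * (2 + z)) * (1 + (2 - euler_mascheroni - Digamma (1 - z)) * z))"
    by (simp only: U_def)
qed

lemma generating_function_form_iff: "generating_function_form a \<longleftrightarrow> a = series_value"
  using generating_function_unique generating_function_series_value by blast

section \<open>The renewal sequence\<close>

text \<open>
  For \<open>k \<ge> 1\<close> this is the eigenfunction expansion for the chain started in 1.
\<close>

lemma renewal_u_eq_series_value:
  assumes "uniform_stick_breaking M W U"
  shows "renewal_u M W U = series_value"
proof
  fix k
  show "renewal_u M W U k = series_value k"
  proof (cases "k = 0")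
    case True
    then show ?thesis
      using zeta_recurrence_series_value by (simp add: renewal_u_def zeta_recurrence_def)
  next
    case False
    have "(\<lambda>i. chain_weight (Suc i) 1 / real (Suc i) ^ k) sums alternating_moment k 1"
      by (rule strict_chain_sums[OF alternating_moment_0 alternating_moment_Suc order_refl])
    moreover have "chain_weight (Suc i) 1 / real (Suc i) ^ k = series_term k i" for i
    proof -
      have "(fact (1 + 1 + Suc i) :: real) = (real (Suc i) + 2) * ((real (Suc i) + 1) * fact (Suc i))"
        by (simp add: algebra_simps)
      then have "chain_weight (Suc i) 1 = 2 / ((real (Suc i) + 1) * (real (Suc i) + 2))"
        unfolding chain_weight_def by (simp del: fact_Suc of_nat_Suc) simp
      then show ?thesis
        by (simp add: series_term_def mult.assoc del: of_nat_Suc)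
    qed
    ultimately have "series_term k sums alternating_moment k 1"
      by simp
    then show ?thesis
      using False assms sums_unique2[OF series_value_sums]
      by (simp add: renewal_u_eq_alternating_moment)
  qed
qed

theorem proposition1p1:
  fixes M :: "'a measure" and W U :: "nat \<Rightarrow> 'a \<Rightarrow> real"
  assumes "uniform_stick_breaking M W U"
  defines "u \<equiv> renewal_u M W U"
  shows "(zeta_recurrence u \<and> zeta_closed_form u \<and> series_form u \<and> generating_function_form u) \<and>
         (\<forall>a. (zeta_recurrence a \<longleftrightarrow> zeta_closed_form a) \<and>
              (zeta_recurrence a \<longleftrightarrow> series_form a) \<and>
              (zeta_recurrence a \<longleftrightarrow> generating_function_form a)) \<and>
         (\<forall>a. zeta_recurrence a \<longrightarrow> a = u)"
  unfolding u_def renewal_u_eq_series_value[OF assms(1)] zeta_recurrence_iff zeta_closed_form_iff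
    series_form_iff generating_function_form_iff
  by simp

end
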